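(* In online matching with online items and non-myopic offline agents with public graph edges: (i) there exists a deterministic tardy mechanism that is truthful for non-myopic agents and is $2$-competitive with respect to the best offline matching, and the factor $2$ is tight even for (non-truthful) deterministic online algorithms, i.e. no deterministic online algorithm is $\alpha$-competitive for $\alpha<2$; (ii) there exists a randomized tardy mechanism that is truthful for non-myopic agents and is $\frac{e}{e-1}$-competitive (in expectation) with respect to the best offline matching, and the factor $\frac{e}{e-1}$ is tight even for (non-truthful) randomized online algorithms, i.e. no randomized online algorithm is $\alpha$-competitive for $\alpha<\frac{e}{e-1}$.
   Context: Model. There is a bipartite graph $G=(B,I;E)$ with a set $B$ of $n$ buyers, known in advance, and a set $I$ of $m$ items arriving one by one in an unknown, possibly adversarial order (item $j$ arrives at time $j$). Buyer $i$ is interested in the items $j$ with $(i,j)\in E$, and has a private value $v_i\ge 0$ for obtaining at least one item she is interested in (value $0$ otherwise). Public graph edges: when item $j$ arrives, the true set of buyers interested in $j$ is revealed to the mechanism (buyers cannot misreport edges); the only private information of buyer $i$ is $v_i$, and her report is a single value $b_i$ which she cannot change once declared. A mechanism (or algorithm), possibly randomized, decides upon the arrival of $j$, immediately and irrevocably and using only information on items up to $j$, either to assign $j$ to a buyer interested in it who has not been assigned an item yet, or to leave $j$ unassigned forever. The result is a matching $\mu$ ($\mu^{-1}_i$ is the item received by $i$, $\emptyset$ if none). The mechanism also charges non-negative payments $p_i$; it is tardy if payments are computed at the end of the whole process. Welfare. $\mathrm{SW}(\mu)=\sum_{i\in B} v_i\cdot \mathbb{I}[(i,\mu^{-1}_i)\in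 E]$, and $\mathrm{OPT}=\mathrm{SW}(\mu^\star)$ where $\mu^\star$ is a maximum weight matching in $G$. A mechanism/algorithm is $\alpha$-competitive ($\alpha\ge 1$) if $\mathrm{OPT}\le\alpha\cdot \mathbb{E}[\mathrm{SW}(\mu)]$ on every instance (with truthful reports). A (non-truthful) algorithm is one that receives the true values and edges online. Truthfulness. Non-myopic buyers know the whole sequence of items and maximize the quasi-linear utility $u_i=v_i\cdot\mathbb{I}[(i,\mu_i^{-1})\in E]-p_i$. A mechanism is truthful for non-myopic agents if, for every realization of the mechanism's random choices and every behavior of the other buyers, each agent maximizes her utility by reporting truthfully. Mechanisms are required to be ex-post individually rational: truthful agents have non-negative utility in every realization. *)

theory Defs
  imports "HOL-Probability.Probability"
begin

text \<open>
  The buyers are \<open>{..<n}\<close>.  An item is identified with its arrival time, so the graph together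
  with the arrival order is a list \<open>N\<close> whose entry \<open>N ! j\<close> is the set of buyers interested in the
  \<open>j\<close>-th item (counted from 0).  A matching is a partial map from items to buyers.
\<close>

type_synonym graph = "nat set list"
type_synonym valuation = "nat \<Rightarrow> real"
type_synonym matching = "nat \<rightharpoonup> nat"

definition valid_input :: "nat \<Rightarrow> valuation \<Rightarrow> graph \<Rightarrow> bool" where
  "valid_input n b N \<longleftrightarrow> \<Union> (set N) \<subseteq> {..<n} \<and> (\<forall>i<n. 0 \<le> b i)"

definition is_matching :: "graph \<Rightarrow> matching \<Rightarrow> bool" where
  "is_matching N \<mu> \<longleftrightarrow>
     dom \<mu> \<subseteq> {..<length N} \<and> (\<forall>j i. \<mu> j = Some i \<longrightarrow> i \<in> N ! j) \<and> inj_on \<mu> (dom \<mu>)"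

definition served :: "graph \<Rightarrow> matching \<Rightarrow> nat \<Rightarrow> bool" where
  "served N \<mu> i \<longleftrightarrow> (\<exists>j<length N. \<mu> j = Some i \<and> i \<in> N ! j)"

definition SW :: "nat \<Rightarrow> valuation \<Rightarrow> graph \<Rightarrow> matching \<Rightarrow> real" where
  "SW n v N \<mu> = (\<Sum>i<n. v i * of_bool (served N \<mu> i))"

definition OPT :: "nat \<Rightarrow> valuation \<Rightarrow> graph \<Rightarrow> real" where
  "OPT n v N = Max (SW n v N ` {\<mu>. is_matching N \<mu>})"

text \<open>The maximum in \<open>OPT\<close> ranges over a finite nonempty set.\<close>

lemma finite_matchings:
  assumes "valid_input n v N"
  shows "finite {\<mu>. is_matching N \<mu>}"
proof -
  have "{\<mu>. is_matching N \<mu>} \<subseteq> (\<Union>D\<in>Pow {..<length N}. {\<mu>. dom \<mu> = D \<and> ran \<mu> \<subseteq> {..<n}})"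
    using assms unfolding is_matching_def valid_input_def ran_def
    by (auto simp: subset_iff dom_def) (metis lessThan_iff nth_mem)
  moreover have "finite (\<Union>D\<in>Pow {..<length N}. {\<mu>::matching. dom \<mu> = D \<and> ran \<mu> \<subseteq> {..<n}})"
    by (auto intro!: finite_set_of_finite_maps dest: finite_subset)
  ultimately show ?thesis
    by (rule finite_subset)
qed

lemma is_matching_empty: "is_matching N Map.empty"
  by (simp add: is_matching_def)

text \<open>
  The decision \<open>A n b h\<close> about an item depends on the buyers, the reports \<open>b\<close> and the list \<open>h\<close>
  of interest sets revealed so far, whose last entry belongs to the current item.  The number of
  items is thus unknown to the algorithm; its own earlier decisions are determined by
  the prefixes of \<open>h\<close>.
\<close>

type_synonym algorithm = "nat \<Rightarrow> valuation \<Rightarrow> graph \<Rightarrow> nat option"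

definition outcome :: "algorithm \<Rightarrow> nat \<Rightarrow> valuation \<Rightarrow> graph \<Rightarrow> matching" where
  "outcome A n b N = (\<lambda>j. if j < length N then A n b (take (Suc j) N) else None)"

definition online_algorithm :: "algorithm \<Rightarrow> bool" where
  "online_algorithm A \<longleftrightarrow> (\<forall>n b N. valid_input n b N \<longrightarrow> is_matching N (outcome A n b N))"

definition competitive :: "real \<Rightarrow> algorithm \<Rightarrow> bool" where
  "competitive \<alpha> A \<longleftrightarrow>
     (\<forall>n v N. valid_input n v N \<longrightarrow> OPT n v N \<le> \<alpha> * SW n v N (outcome A n v N))"

text \<open>
  Payments are tardy: \<open>P n b N i\<close> is what buyer \<open>i\<close> pays, computed from the complete sequence \<open>N\<close>.
\<close>

type_synonym payment = "nat \<Rightarrow> valuation \<Rightarrow> graph \<Rightarrow> nat \<Rightarrow> real"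

text \<open>
  A buyer need not have declared her value before the first item she is interested in arrives.
  A mechanism must therefore not use the reports of buyers that have not appeared yet.
  This is not demanded of an \<open>online_algorithm\<close>, so that lower bounds for online algorithms
  also cover those that know all values in advance.
\<close>

definition uses_declared_reports :: "algorithm \<Rightarrow> payment \<Rightarrow> bool" where
  "uses_declared_reports A P \<longleftrightarrow>
     (\<forall>n b b' N. valid_input n b N \<and> valid_input n b' N \<and> (\<forall>i \<in> \<Union> (set N). b i = b' i) \<longrightarrow>
        A n b N = A n b' N \<and> (\<forall>i<n. P n b N i = P n b' N i))"

definition utility ::
  "algorithm \<Rightarrow> payment \<Rightarrow> nat \<Rightarrow> valuation \<Rightarrow> graph \<Rightarrow> nat \<Rightarrow> real \<Rightarrow> real" where
  "utility A P n b N i x = x * of_bool (served N (outcome A n b N) i) - P n b N i"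

definition individually_rational :: "algorithm \<Rightarrow> payment \<Rightarrow> bool" where
  "individually_rational A P \<longleftrightarrow>
     (\<forall>n b N. valid_input n b N \<longrightarrow> (\<forall>i<n. 0 \<le> utility A P n b N i (b i)))"

definition tardy_mechanism :: "algorithm \<Rightarrow> payment \<Rightarrow> bool" where
  "tardy_mechanism A P \<longleftrightarrow>
     online_algorithm A \<and> uses_declared_reports A P \<and>
     (\<forall>n b N. valid_input n b N \<longrightarrow> (\<forall>i<n. 0 \<le> P n b N i)) \<and>
     individually_rational A P"

text \<open>
  Buyer \<open>i\<close> has true value \<open>x\<close>; the other entries of \<open>b\<close> are arbitrary reports of the other buyers.
  The whole sequence \<open>N\<close> is fixed before the deviation \<open>y\<close> is chosen (non-myopic buyers).
\<close>

definition truthful :: "algorithm \<Rightarrow> payment \<Rightarrow> bool" where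
  "truthful A P \<longleftrightarrow>
     (\<forall>n b N. valid_input n b N \<longrightarrow>
        (\<forall>i<n. \<forall>x\<ge>0. \<forall>y\<ge>0.
           utility A P n (b(i := y)) N i x \<le> utility A P n (b(i := x)) N i x))"

text \<open>Random choices are a seed drawn from a probability space before the process starts.\<close>

definition randomized_online_algorithm :: "'w measure \<Rightarrow> ('w \<Rightarrow> algorithm) \<Rightarrow> bool" where
  "randomized_online_algorithm M A \<longleftrightarrow>
     prob_space M \<and> (\<forall>\<omega>\<in>space M. online_algorithm (A \<omega>)) \<and>
     (\<forall>n b N. valid_input n b N \<longrightarrow> (\<lambda>\<omega>. A \<omega> n b N) \<in> measurable M (count_space UNIV))"

definition randomized_competitive :: "real \<Rightarrow> 'w measure \<Rightarrow> ('w \<Rightarrow> algorithm) \<Rightarrow> bool" where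
  "randomized_competitive \<alpha> M A \<longleftrightarrow>
     (\<forall>n v N. valid_input n v N \<longrightarrow>
        OPT n v N \<le> \<alpha> * (LINT \<omega>|M. SW n v N (outcome (A \<omega>) n v N)))"

definition randomized_tardy_mechanism ::
  "'w measure \<Rightarrow> ('w \<Rightarrow> algorithm) \<Rightarrow> ('w \<Rightarrow> payment) \<Rightarrow> bool" where
  "randomized_tardy_mechanism M A P \<longleftrightarrow>
     randomized_online_algorithm M A \<and> (\<forall>\<omega>\<in>space M. tardy_mechanism (A \<omega>) (P \<omega>)) \<and>
     (\<forall>n b N i. valid_input n b N \<and> i < n \<longrightarrow> (\<lambda>\<omega>. P \<omega> n b N i) \<in> borel_measurable M)"

definition randomized_truthful ::
  "'w measure \<Rightarrow> ('w \<Rightarrow> algorithm) \<Rightarrow> ('w \<Rightarrow> payment) \<Rightarrow> bool" where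
  "randomized_truthful M A P \<longleftrightarrow> (\<forall>\<omega>\<in>space M. truthful (A \<omega>) (P \<omega>))"

end

theory Submission
  imports Defs "HOL-Combinatorics.Permutations" "HOL-Real_Asymp.Real_Asymp"
begin

text \<open>
  Both mechanisms are greedy: buyer \<open>i\<close> has the score \<open>b i * c i\<close>, and each item goes to the
  interested unassigned buyer of highest score.  Compare the process with the one from which
  buyer \<open>i\<close> is removed.  The two agree until \<open>i\<close> is served, so \<open>i\<close> is served iff her score beats
  all free competitors for some item in the process without her.  This condition is monotone in
  \<open>b i\<close>, so charging the threshold report is truthful.  Moreover her presence never
  lowers the score for which an item is sold.  Hence for every edge \<open>(i, j)\<close>, either \<open>i\<close> is served
  or item \<open>j\<close> is sold for at least the score of \<open>i\<close>.

  With \<open>c = 1\<close> this shows that the values of the served buyers, charged once to the buyers and once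
  to the items, cover all edges, giving ratio \<open>2\<close>.  With \<open>c i = 1 - exp (y i - 1)\<close> for independent
  uniform seeds \<open>y i\<close> (vertex-weighted Ranking), averaging over \<open>y i\<close> alone shows that every edge is covered in
  expectation up to the factor \<open>1 - 1 / e\<close>.

  Against deterministic algorithms, the buyer chosen for an item wanted by both of two buyers is
  the only one to want the next item.  Against randomized ones, order \<open>n\<close> buyers of value 1 at random,
  and let item \<open>t\<close> interest the buyers of rank at least \<open>t\<close>.  By symmetry it is assigned to the
  buyer of rank \<open>k\<close> with probability at most \<open>1 / (n - t)\<close>, so at most about \<open>(1 - 1 / e) n\<close> buyers
  are served on average.
\<close>

section \<open>Greedy assignment by scores\<close>

text \<open>Ties go to the smaller index, so \<open>beats s\<close> is a linear order. Favourites
  are therefore unique, and comparisons alone determine the whole process.\<close>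

definition beats :: "(nat \<Rightarrow> real) \<Rightarrow> nat \<Rightarrow> nat \<Rightarrow> bool" where
  "beats s i k \<longleftrightarrow> s k < s i \<or> s k = s i \<and> i \<le> k"

lemma beats_refl [simp]: "beats s i i"
  by (simp add: beats_def)

lemma beats_total: "beats s i k \<or> beats s k i"
  by (auto simp: beats_def)

lemma beats_trans: "beats s i k \<Longrightarrow> beats s k l \<Longrightarrow> beats s i l"
  by (auto simp: beats_def)

lemma beats_antisym: "beats s i k \<Longrightarrow> beats s k i \<Longrightarrow> i = k"
  by (auto simp: beats_def)

lemma beats_imp_le: "beats s i k \<Longrightarrow> s k \<le> s i"
  by (auto simp: beats_def)

definition favourite :: "(nat \<Rightarrow> real) \<Rightarrow> nat set \<Rightarrow> nat option" where
  "favourite s S = (if S = {} then None else Some (THE i. i \<in> S \<and> (\<forall>k\<in>S. beats s i k)))"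

lemma favourite_eq_None_iff: "favourite s S = None \<longleftrightarrow> S = {}"
  by (simp add: favourite_def)

lemma favourite_eq_Some_iff:
  assumes "finite S"
  shows "favourite s S = Some i \<longleftrightarrow> i \<in> S \<and> (\<forall>k\<in>S. beats s i k)"
proof (cases "S = {}")
  case False
  with assms have "\<exists>i. i \<in> S \<and> (\<forall>k\<in>S. beats s i k)"
  proof (induction rule: finite_ne_induct)
    case (insert x F)
    then obtain i where i: "i \<in> F" "\<forall>k\<in>F. beats s i k" by blast
    show ?case
    proof (cases "beats s i x")
      case True
      with i show ?thesis by blast
    next
      case False
      then have "beats s x i" using beats_total by blast
      with i show ?thesis by (metis beats_refl beats_trans insert_iff)
    qed
  qed simp
  then have ex1: "\<exists>!i. i \<in> S \<and> (\<forall>k\<in>S. beats s i k)"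
    using beats_antisym by blast
  define m where "m = (THE i. i \<in> S \<and> (\<forall>k\<in>S. beats s i k))"
  have "m \<in> S \<and> (\<forall>k\<in>S. beats s m k)" unfolding m_def by (rule theI'[OF ex1])
  moreover have "favourite s S = Some m" using False by (simp add: favourite_def m_def)
  ultimately show ?thesis using ex1 by auto
qed (simp add: favourite_def)

lemma favourite_mem: "finite S \<Longrightarrow> favourite s S = Some i \<Longrightarrow> i \<in> S"
  by (simp add: favourite_eq_Some_iff)

lemma favourite_subset:
  assumes "finite S" "favourite s S = Some i" "T \<subseteq> S" "i \<in> T"
  shows "favourite s T = Some i"
  using assms by (auto simp: favourite_eq_Some_iff finite_subset)

lemma favourite_cong:
  assumes "finite S" "\<And>i k. i \<in> S \<Longrightarrow> k \<in> S \<Longrightarrow> beats s i k = beats s' i k"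
  shows "favourite s S = favourite s' S"
proof (cases "favourite s' S")
  case (Some i)
  then have "favourite s S = Some i" using assms by (auto simp: favourite_eq_Some_iff)
  with Some show ?thesis by simp
next
  case None
  then have "S = {}" by (simp only: favourite_eq_None_iff)
  then show ?thesis by (simp add: favourite_def)
qed

definition used :: "(nat \<Rightarrow> real) \<Rightarrow> nat set \<Rightarrow> graph \<Rightarrow> nat set" where
  "used s = foldl (\<lambda>U S. U \<union> set_option (favourite s (S - U)))"

definition choice :: "(nat \<Rightarrow> real) \<Rightarrow> nat set \<Rightarrow> graph \<Rightarrow> nat \<Rightarrow> nat option" where
  "choice s U N j = favourite s (N ! j - used s U (take j N))"

lemma used_Nil [simp]: "used s U [] = U"
  by (simp add: used_def)

lemma used_Cons: "used s U (S # N) = used s (U \<union> set_option (favourite s (S - U))) N"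
  by (simp add: used_def)

lemma used_append: "used s U (N @ N') = used s (used s U N) N'"
  by (simp add: used_def)

lemma used_snoc:
  "used s U (N @ [S]) = used s U N \<union> set_option (favourite s (S - used s U N))"
  by (simp add: used_def)

lemma used_take_Suc:
  "j < length N \<Longrightarrow> used s U (take (Suc j) N) = used s U (take j N) \<union> set_option (choice s U N j)"
  by (simp add: take_Suc_conv_app_nth used_snoc choice_def)

lemma used_superset: "U \<subseteq> used s U N"
  by (induction N rule: rev_induct) (auto simp: used_snoc)

lemma used_take_mono: "j \<le> k \<Longrightarrow> used s U (take j N) \<subseteq> used s U (take k N)"
  using used_superset[of "used s U (take j N)" s "take (k - j) (drop j N)"]
  by (simp add: used_append[symmetric] take_add[symmetric])

lemma used_take_subset: "used s U (take j N) \<subseteq> used s U N"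
  using used_superset[of "used s U (take j N)" s "drop j N"]
  by (simp add: used_append[symmetric])

lemma used_eq_choices:
  "used s U N = U \<union> {i. \<exists>j<length N. choice s U N j = Some i}"
proof -
  have "used s U (take m N) = U \<union> {i. \<exists>j<m. choice s U N j = Some i}" if "m \<le> length N" for m
    using that
  proof (induction m)
    case (Suc m)
    then have "used s U (take (Suc m) N) =
      U \<union> {i. \<exists>j<m. choice s U N j = Some i} \<union> set_option (choice s U N m)"
      by (simp add: used_take_Suc)
    also have "\<dots> = U \<union> {i. \<exists>j<Suc m. choice s U N j = Some i}"
      by (auto simp: less_Suc_eq)
    finally show ?case .
  qed simp
  from this[of "length N"] show ?thesis by simp
qed

lemma choice_memD:
  assumes "\<forall>S\<in>set N. finite S" "j < length N" "choice s U N j = Some i"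
  shows "i \<in> N ! j" "i \<notin> used s U (take j N)"
  using assms favourite_mem[of "N ! j - used s U (take j N)" s i] by (auto simp: choice_def favourite_eq_None_iff)

text \<open>Only comparisons between buyers outside \<open>U\<close> are ever made. In particular
  the run from \<open>{i}\<close> never looks at the score of \<open>i\<close>.\<close>

lemma used_cong:
  assumes "\<forall>S\<in>set N. finite S"
    "\<And>i k. i \<in> \<Union>(set N) - U \<Longrightarrow> k \<in> \<Union>(set N) - U \<Longrightarrow> beats s i k = beats s' i k"
  shows "used s U N = used s' U N"
  using assms
proof (induction N rule: rev_induct)
  case (snoc S N)
  then have eq: "used s U N = used s' U N" by auto
  have "favourite s (S - used s U N) = favourite s' (S - used s U N)"
    using snoc.prems used_superset[of U s N] by (intro favourite_cong) auto
  with eq show ?case by (simp add: used_snoc)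
qed simp

lemma choice_cong:
  assumes "\<forall>S\<in>set N. finite S" "j < length N"
    "\<And>i k. i \<in> \<Union>(set N) - U \<Longrightarrow> k \<in> \<Union>(set N) - U \<Longrightarrow> beats s i k = beats s' i k"
  shows "choice s U N j = choice s' U N j"
proof -
  have "used s U (take j N) = used s' U (take j N)"
    using assms by (intro used_cong) (auto dest!: in_set_takeD)
  moreover have "favourite s (N ! j - used s U (take j N)) = favourite s' (N ! j - used s U (take j N))"
    using assms used_superset[of U s "take j N"] nth_mem[OF assms(2)]
    by (intro favourite_cong) blast+
  ultimately show ?thesis by (simp add: choice_def)
qed

section \<open>The effect of removing one buyer from the run\<close>

lemma used_mono:
  assumes "\<forall>S\<in>set N. finite S" "U \<subseteq> U'" "U' \<subseteq> insert z U"
  shows "used s U N \<subseteq> used s U' N"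
  using assms
proof (induction N arbitrary: U U' z)
  case (Cons S N)
  let ?f = "favourite s (S - U)" and ?f' = "favourite s (S - U')"
  have fin: "finite (S - U)" "finite (S - U')" using Cons.prems by auto
  \<comment> \<open>One item preserves the inclusion: the favourite \<open>x\<close> of the run from
    \<open>U\<close> is either already taken in the other run, or still free there and then its
    favourite too. If \<open>x\<close> is the extra buyer, whoever the other run chooses, if anyone,
    becomes the new extra buyer.\<close>
  have "\<exists>z. U \<union> set_option ?f \<subseteq> U' \<union> set_option ?f' \<and>
            U' \<union> set_option ?f' \<subseteq> insert z (U \<union> set_option ?f)"
  proof (cases ?f)
    case None
    then have "S - U' = {}" using Cons.prems by (auto simp: favourite_eq_None_iff)
    then have "?f' = None" by (simp add: favourite_eq_None_iff)
    with None Cons.prems show ?thesis by auto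
  next
    case (Some x)
    then have x: "x \<in> S - U" using fin favourite_mem by blast
    show ?thesis
    proof (cases "x \<in> U'")
      case True
      then have "insert x U = U'" using x Cons.prems by blast
      then show ?thesis using Some by (cases ?f') auto
    next
      case False
      then have "?f' = Some x"
        using favourite_subset[OF fin(1) Some, of "S - U'"] x Cons.prems by auto
      then show ?thesis using Some Cons.prems by auto
    qed
  qed
  then obtain z' where "U \<union> set_option ?f \<subseteq> U' \<union> set_option ?f'"
    "U' \<union> set_option ?f' \<subseteq> insert z' (U \<union> set_option ?f)" by blast
  then show ?case using Cons.IH Cons.prems(1) by (simp add: used_Cons)
qed simp

text \<open>A buyer who is never chosen is never the favourite, and dropping a non-favourite from
  the candidates leaves the favourite unchanged.\<close>

lemma used_insert_absent:
  assumes "\<forall>S\<in>set N. finite S" "i \<notin> used s U N"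
  shows "used s (insert i U) N = insert i (used s U N)"
  using assms
proof (induction N rule: rev_induct)
  case (snoc S N)
  let ?V = "used s U N"
  have fin: "finite (S - ?V)" using snoc.prems by auto
  have IH: "used s (insert i U) N = insert i ?V" and i: "favourite s (S - ?V) \<noteq> Some i"
    using snoc by (auto simp: used_snoc)
  have "favourite s (S - insert i ?V) = favourite s (S - ?V)"
  proof (cases "favourite s (S - ?V)")
    case None
    then have "S - ?V = {}" "S - insert i ?V = {}" by (auto simp: favourite_eq_None_iff)
    then show ?thesis by (simp only:)
  next
    case (Some x)
    then show ?thesis
      using favourite_subset[OF fin Some, of "S - insert i ?V"] i favourite_mem[OF fin Some] by auto
  qed
  with IH show ?case by (simp add: used_snoc)
qed simp

text \<open>Until \<open>i\<close> is served, the actual run agrees with the run without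
  \<open>i\<close>. The right-hand side isolates the influence of \<open>s i\<close>: it enters only
  through the comparisons \<open>beats s i k\<close>.\<close>

lemma mem_used_iff:
  assumes fin: "\<forall>S\<in>set N. finite S"
  shows "i \<in> used s {} N \<longleftrightarrow>
    (\<exists>t<length N. i \<in> N ! t \<and> (\<forall>k\<in>N ! t - used s {i} (take t N). beats s i k))"
    (is "?L \<longleftrightarrow> ?R")
proof
  have fin': "finite (N ! t - U)" if "t < length N" for t U
    using fin that by auto
  have absent: "used s {i} (take t N) = insert i (used s {} (take t N))"
    if "i \<notin> used s {} (take t N)" for t
    using used_insert_absent[of "take t N" i s "{}"] fin that by (auto dest: in_set_takeD)
  {
    assume ?L
    then obtain t where t: "t < length N" "choice s {} N t = Some i"
      by (auto simp: used_eq_choices)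
    from choice_memD[OF fin this] have "i \<in> N ! t" "i \<notin> used s {} (take t N)" .
    with t absent show ?R
      by (force simp: choice_def favourite_eq_Some_iff fin')
  next
    assume ?R
    then obtain t where t: "t < length N" "i \<in> N ! t"
      "\<forall>k\<in>N ! t - used s {i} (take t N). beats s i k" by blast
    show ?L
    proof (rule ccontr)
      assume n: "\<not> ?L"
      then have "i \<notin> used s {} (take t N)" using used_take_subset by blast
      with t absent have "choice s {} N t = Some i"
        by (auto simp: choice_def favourite_eq_Some_iff fin')
      with t n show False by (auto simp: used_eq_choices)
    qed
  }
qed

text \<open>Raising \<open>s i\<close> leaves the run without \<open>i\<close> untouched and can
  only turn comparisons in favour of \<open>i\<close>.\<close>

lemma used_score_mono:
  assumes fin: "\<forall>S\<in>set N. finite S"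
    and "i \<in> used s {} N" "s i \<le> s' i" "\<And>k. k \<noteq> i \<Longrightarrow> s' k = s k"
  shows "i \<in> used s' {} N"
proof -
  have eq: "used s {i} (take t N) = used s' {i} (take t N)" for t
    using assms by (intro used_cong) (auto simp: beats_def dest: in_set_takeD)
  have "beats s i k \<Longrightarrow> beats s' i k" for k
    using assms(3) assms(4)[of k] by (cases "k = i") (auto simp: beats_def)
  then show ?thesis
    using assms(2) eq unfolding mem_used_iff[OF fin] by blast
qed

definition item_value :: "(nat \<Rightarrow> real) \<Rightarrow> nat option \<Rightarrow> real" where
  "item_value f x = (case x of None \<Rightarrow> 0 | Some i \<Rightarrow> f i)"

lemma item_value_simps [simp]: "item_value f None = 0" "item_value f (Some i) = f i"
  by (simp_all add: item_value_def)

text \<open>By \<open>used_mono\<close> the winner of item \<open>j\<close> in the run without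
  \<open>i\<close> is still free at that time in the actual run, whose choice therefore scores at
  least as much. An unsold item counts 0, hence the nonnegative scores.\<close>

lemma item_value_choice_absent_le:
  assumes fin: "\<forall>S\<in>set N. finite S" and j: "j < length N"
    and nonneg: "\<And>k. k \<in> N ! j \<Longrightarrow> 0 \<le> s k"
  shows "item_value s (choice s {i} N j) \<le> item_value s (choice s {} N j)"
proof (cases "choice s {i} N j")
  case None
  moreover have "0 \<le> item_value s (choice s {} N j)"
  proof (cases "choice s {} N j")
    case (Some k)
    then show ?thesis using nonneg choice_memD(1)[OF fin j Some] by simp
  qed simp
  ultimately show ?thesis by simp
next
  case (Some k)
  have "used s {} (take j N) \<subseteq> used s {i} (take j N)"
    using fin by (intro used_mono[where z = i]) (auto dest: in_set_takeD)
  with choice_memD[OF fin j Some] have k: "k \<in> N ! j - used s {} (take j N)" by auto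
  have finj: "finite (N ! j - used s {} (take j N))" using fin j by auto
  obtain l where l: "choice s {} N j = Some l"
    using k favourite_eq_None_iff by (metis choice_def empty_iff option.exhaust)
  then have "beats s l k"
    using k finj unfolding choice_def by (simp add: favourite_eq_Some_iff)
  then have "s k \<le> s l" by (rule beats_imp_le)
  with Some l show ?thesis by simp
qed

text \<open>The choice in the run without \<open>i\<close> is the best remaining candidate, so
  outbidding it means outbidding all of them.\<close>

lemma mem_used_if_score_greater:
  assumes fin: "\<forall>S\<in>set N. finite S" and j: "j < length N" "i \<in> N ! j"
    and "item_value s (choice s {i} N j) < s i"
  shows "i \<in> used s {} N"
proof -
  have finj: "finite (N ! j - used s {i} (take j N))" using fin j by auto
  have "beats s i k" if k: "k \<in> N ! j - used s {i} (take j N)" for k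
  proof -
    obtain l where l: "choice s {i} N j = Some l"
      using k favourite_eq_None_iff by (metis choice_def empty_iff option.exhaust)
    then have "beats s l k"
      using k finj unfolding choice_def by (simp add: favourite_eq_Some_iff)
    then have "s k \<le> s l" by (rule beats_imp_le)
    with l assms(4) show ?thesis by (simp add: beats_def)
  qed
  with j show ?thesis unfolding mem_used_iff[OF fin] by blast
qed

text \<open>Allows the seed of \<open>i\<close> to be averaged alone: the score she has to exceed at
  item \<open>j\<close> stays fixed while her own score varies.\<close>

lemma item_value_choice_absent_cong:
  assumes fin: "\<forall>S\<in>set N. finite S" and j: "j < length N"
    and "\<And>k. k \<noteq> i \<Longrightarrow> s k = s' k"
  shows "item_value s (choice s {i} N j) = item_value s' (choice s' {i} N j)"
proof -
  have eq: "choice s {i} N j = choice s' {i} N j"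
  proof (rule choice_cong[OF fin j])
    fix a k assume "a \<in> \<Union>(set N) - {i}" "k \<in> \<Union>(set N) - {i}"
    then have "s a = s' a" "s k = s' k" using assms(3) by simp_all
    then show "beats s a k = beats s' a k" by (simp add: beats_def)
  qed
  show ?thesis
  proof (cases "choice s {i} N j")
    case (Some k)
    then have "k \<noteq> i"
      using choice_memD(2)[OF fin j Some] used_superset[of "{i}" s "take j N"] by auto
    with Some eq assms(3) show ?thesis by simp
  qed (use eq in simp)
qed

text \<open>An algorithm has no state, so the assigned buyers are recomputed by replaying
  \<open>butlast h\<close>. The multiplier \<open>c\<close> is constantly 1 for the deterministic
  mechanism and a discount given by the seed for Ranking.\<close>

definition greedy :: "(nat \<Rightarrow> real) \<Rightarrow> algorithm" where
  "greedy c n b h =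
     (if h = [] then None
      else favourite (\<lambda>i. b i * c i) (last h - used (\<lambda>i. b i * c i) {} (butlast h)))"

lemma valid_input_finite: "valid_input n b N \<Longrightarrow> \<forall>S\<in>set N. finite S"
  by (auto simp: valid_input_def intro: finite_subset[of _ "{..<n}"])

lemma valid_input_take: "valid_input n b N \<Longrightarrow> valid_input n b (take j N)"
  by (auto simp: valid_input_def dest: in_set_takeD)

lemma valid_input_upd: "valid_input n b N \<Longrightarrow> 0 \<le> y \<Longrightarrow> valid_input n (b(i := y)) N"
  by (auto simp: valid_input_def)

lemma outcome_greedy:
  "outcome (greedy c) n b N j = (if j < length N then choice (\<lambda>i. b i * c i) {} N j else None)"
proof (cases "j < length N")
  case True
  then have "last (take (Suc j) N) = N ! j" "butlast (take (Suc j) N) = take j N"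
    by (simp_all add: take_Suc_conv_app_nth)
  with True show ?thesis by (auto simp: outcome_def greedy_def choice_def)
qed (simp add: outcome_def)

lemma online_algorithm_greedy: "online_algorithm (greedy c)"
  unfolding online_algorithm_def
proof (intro allI impI)
  fix n b N assume v: "valid_input n b N"
  let ?s = "\<lambda>i. b i * c i" let ?\<mu> = "outcome (greedy c) n b N"
  note fin = valid_input_finite[OF v]
  have neq: "choice ?s {} N j' \<noteq> Some i"
    if "j < j'" "j' < length N" "choice ?s {} N j = Some i" for i j j'
  proof
    assume j': "choice ?s {} N j' = Some i"
    have "i \<in> used ?s {} (take (Suc j) N)" using that by (simp add: used_take_Suc)
    then have "i \<in> used ?s {} (take j' N)" using used_take_mono[of "Suc j" j'] that by auto
    with choice_memD(2)[OF fin _ j'] that show False by simp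
  qed
  show "is_matching N ?\<mu>"
    unfolding is_matching_def
  proof (intro conjI allI impI)
    show "inj_on ?\<mu> (dom ?\<mu>)"
    proof (rule inj_onI)
      fix x y assume "x \<in> dom ?\<mu>" "y \<in> dom ?\<mu>" "?\<mu> x = ?\<mu> y"
      then show "x = y"
        using neq[of x y] neq[of y x]
        by (cases x y rule: linorder_cases) (auto simp: outcome_greedy split: if_splits)
    qed
  qed (auto simp: outcome_greedy choice_memD(1)[OF fin] split: if_splits)
qed

lemma served_greedy_iff:
  assumes "valid_input n b N"
  shows "served N (outcome (greedy c) n b N) i \<longleftrightarrow> i \<in> used (\<lambda>i. b i * c i) {} N"
  using choice_memD(1)[OF valid_input_finite[OF assms]]
  by (auto simp: served_def outcome_greedy used_eq_choices)

lemma greedy_cong: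
  assumes v: "valid_input n b N"
    and "\<And>i k. i \<in> \<Union>(set N) \<Longrightarrow> k \<in> \<Union>(set N) \<Longrightarrow>
      beats (\<lambda>i. b i * c i) i k = beats (\<lambda>i. b' i * c' i) i k"
  shows "outcome (greedy c) n b N = outcome (greedy c') n b' N"
  using choice_cong[OF valid_input_finite[OF v], of _ "{}" "\<lambda>i. b i * c i" "\<lambda>i. b' i * c' i"] assms(2)
  by (intro ext) (simp add: outcome_greedy)

section \<open>Threshold prices\<close>

text \<open>Myerson's critical value. It refers to \<open>b i\<close> only through the question
  whether buyer \<open>i\<close> is served.\<close>

definition threshold_price :: "algorithm \<Rightarrow> payment" where
  "threshold_price A n b N i =
     (if served N (outcome A n b N) i
      then Inf {y. 0 \<le> y \<and> served N (outcome A n (b(i := y)) N) i} else 0)"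

definition monotone_allocation :: "algorithm \<Rightarrow> bool" where
  "monotone_allocation A \<longleftrightarrow>
     (\<forall>n b N i x y. valid_input n b N \<and> i < n \<and> 0 \<le> x \<and> x \<le> y \<and>
        served N (outcome A n (b(i := x)) N) i \<longrightarrow> served N (outcome A n (b(i := y)) N) i)"

lemma threshold_price_nonneg:
  assumes "0 \<le> b i"
  shows "0 \<le> threshold_price A n b N i"
proof -
  have "0 \<le> Inf {y. 0 \<le> y \<and> served N (outcome A n (b(i := y)) N) i}"
    if "served N (outcome A n b N) i"
    using that assms by (intro cInf_greatest) (auto intro!: exI[of _ "b i"])
  then show ?thesis by (simp add: threshold_price_def)
qed

lemma threshold_price_le:
  assumes "served N (outcome A n (b(i := y)) N) i" "served N (outcome A n (b(i := x)) N) i" "0 \<le> y"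
  shows "threshold_price A n (b(i := x)) N i \<le> y"
  using assms by (auto simp: threshold_price_def intro!: cInf_lower bdd_belowI[of _ 0])

lemma threshold_price_indep:
  assumes "served N (outcome A n (b(i := y)) N) i" "served N (outcome A n (b(i := x)) N) i"
  shows "threshold_price A n (b(i := x)) N i = threshold_price A n (b(i := y)) N i"
  using assms by (simp add: threshold_price_def)

lemma individually_rational_threshold_price: "individually_rational A (threshold_price A)"
  unfolding individually_rational_def
proof (intro allI impI)
  fix n b N i assume "valid_input n b N" "i < n"
  then have "0 \<le> b i" by (simp add: valid_input_def)
  then show "0 \<le> utility A (threshold_price A) n b N i (b i)"
    using threshold_price_le[of N A n b i "b i" "b i"]
    by (auto simp: utility_def threshold_price_def)
qed

text \<open>All winning reports pay the same price, so a misreport matters only if it changes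
  whether \<open>i\<close> is served. If the true value \<open>x\<close> wins, losing yields 0,
  which is no better. If \<open>x\<close> loses, monotonicity puts every winning report at or above
  \<open>x\<close>, so winning costs at least \<open>x\<close>.\<close>

lemma truthful_threshold_price:
  assumes mono: "monotone_allocation A"
  shows "truthful A (threshold_price A)"
  unfolding truthful_def
proof (intro allI impI)
  fix n b N i and x y :: real
  assume v: "valid_input n b N" and i: "i < n" and x: "0 \<le> x" and y: "0 \<le> y"
  let ?served = "\<lambda>z. served N (outcome A n (b(i := z)) N) i"
  let ?u = "\<lambda>z. utility A (threshold_price A) n (b(i := z)) N i x"
  have unserved: "?u z = 0" if "\<not> ?served z" for z
    using that by (simp add: utility_def threshold_price_def)
  have ir: "0 \<le> ?u x"
    using individually_rational_threshold_price[of A] valid_input_upd[OF v x, of i] i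
    unfolding individually_rational_def by (metis fun_upd_same)
  show "?u y \<le> ?u x"
  proof (cases "?served x")
    case True
    then show ?thesis
      using ir unserved[of y] threshold_price_indep[of N A n b i x y]
      by (cases "?served y") (simp_all add: utility_def)
  next
    case False
    have "x \<le> threshold_price A n (b(i := y)) N i" if "?served y"
    proof -
      have "x \<le> z" if "0 \<le> z" "?served z" for z
        using mono v i False that unfolding monotone_allocation_def by (meson nle_le)
      then have "x \<le> Inf {z. 0 \<le> z \<and> ?served z}"
        using \<open>?served y\<close> y by (intro cInf_greatest) auto
      with that show ?thesis by (simp add: threshold_price_def)
    qed
    then show ?thesis
      using unserved[OF False] unserved[of y] by (cases "?served y") (simp_all add: utility_def)
  qed
qed

lemma monotone_allocation_greedy:
  assumes c: "\<And>i. 0 \<le> c i"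
  shows "monotone_allocation (greedy c)"
  unfolding monotone_allocation_def
proof (intro allI impI, elim conjE)
  fix n b N i and x y :: real
  assume v: "valid_input n b N" and x: "0 \<le> x" "x \<le> y"
    and s: "served N (outcome (greedy c) n (b(i := x)) N) i"
  have "valid_input n (b(i := x)) N" "valid_input n (b(i := y)) N"
    using v x by (auto intro: valid_input_upd)
  moreover have "x * c i \<le> y * c i" using x c by (intro mult_right_mono)
  ultimately show "served N (outcome (greedy c) n (b(i := y)) N) i"
    using s used_score_mono[OF valid_input_finite[OF v], of i "\<lambda>k. (b(i := x)) k * c k" "\<lambda>k. (b(i := y)) k * c k"]
    by (simp add: served_greedy_iff)
qed

lemma uses_declared_reports_greedy: "uses_declared_reports (greedy c) (threshold_price (greedy c))"
  unfolding uses_declared_reports_def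
proof (intro allI impI, elim conjE, intro conjI allI impI)
  fix n b b' N
  assume v: "valid_input n b N" "valid_input n b' N" and eq: "\<forall>i\<in>\<Union>(set N). b i = b' i"
  have *: "outcome (greedy c) n d N = outcome (greedy c) n d' N"
    if "valid_input n d N" "\<forall>i\<in>\<Union>(set N). d i = d' i" for d d'
  proof (rule greedy_cong[OF that(1)])
    fix i k assume "i \<in> \<Union>(set N)" "k \<in> \<Union>(set N)"
    with that(2) have "d i = d' i" "d k = d' k" by blast+
    then show "beats (\<lambda>i. d i * c i) i k = beats (\<lambda>i. d' i * c i) i k" by (simp add: beats_def)
  qed
  show "greedy c n b N = greedy c n b' N"
  proof (cases N rule: rev_cases)
    case Nil
    then show ?thesis by (simp add: greedy_def)
  next
    \<comment> \<open>The decision on the prefix \<open>N\<close> is the last entry of the outcome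
      on \<open>N\<close>.\<close>
    case (snoc N' S)
    then show ?thesis
      using fun_cong[OF *[OF v(1) eq], of "length N'"] by (simp add: outcome_def)
  qed
  fix i assume "i < n"
  \<comment> \<open>The price also involves runs with a changed report of \<open>i\<close>. The two
    profiles receive the same change, so they still agree on the buyers that have appeared.\<close>
  have "outcome (greedy c) n (b(i := y)) N = outcome (greedy c) n (b'(i := y)) N" if "0 \<le> y" for y
    using eq by (intro * valid_input_upd v that) auto
  then show "threshold_price (greedy c) n b N i = threshold_price (greedy c) n b' N i"
    using *[OF v(1) eq] by (simp add: threshold_price_def cong: conj_cong)
qed

lemma tardy_mechanism_greedy: "tardy_mechanism (greedy c) (threshold_price (greedy c))"
  by (auto simp: tardy_mechanism_def online_algorithm_greedy uses_declared_reports_greedy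
      individually_rational_threshold_price valid_input_def intro!: threshold_price_nonneg)

section \<open>Deterministic competitive ratio\<close>

text \<open>A matching serves each buyer at most once, so welfare can be counted by items. The
  weight \<open>f\<close> is arbitrary because cover weights and scores are counted this way as well
  as values.\<close>

lemma SW_eq_sum_items:
  assumes v: "valid_input n b N" and m: "is_matching N \<mu>"
  shows "SW n f N \<mu> = (\<Sum>j<length N. item_value f (\<mu> j))"
proof -
  have dom: "dom \<mu> \<subseteq> {..<length N}" and inj: "inj_on \<mu> (dom \<mu>)"
    and mem: "\<And>j i. \<mu> j = Some i \<Longrightarrow> i \<in> N ! j"
    using m by (auto simp: is_matching_def)
  have ran: "ran \<mu> = {i\<in>{..<n}. served N \<mu> i}"
  proof (intro set_eqI iffI)
    fix i assume "i \<in> ran \<mu>"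
    then obtain j where j: "\<mu> j = Some i" by (auto simp: ran_def)
    then have "j < length N" "i \<in> N ! j" using dom mem by auto
    moreover from this have "i < n" using v nth_mem unfolding valid_input_def by blast
    ultimately show "i \<in> {i\<in>{..<n}. served N \<mu> i}" using j by (auto simp: served_def)
  qed (auto simp: served_def ran_def)
  have inj': "inj_on (the \<circ> \<mu>) (dom \<mu>)"
    using inj by (auto simp: inj_on_def dom_def)
  have img: "(the \<circ> \<mu>) ` dom \<mu> = ran \<mu>"
    by (force simp: ran_def dom_def image_iff)
  have "(\<Sum>j<length N. item_value f (\<mu> j)) = (\<Sum>j\<in>dom \<mu>. item_value f (\<mu> j))"
    using dom by (intro sum.mono_neutral_right) (auto simp: item_value_def dom_def)
  also have "\<dots> = (\<Sum>j\<in>dom \<mu>. f ((the \<circ> \<mu>) j))"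
    by (intro sum.cong) auto
  also have "\<dots> = (\<Sum>i\<in>ran \<mu>. f i)"
    using sum.reindex[OF inj', of f] img by (simp add: comp_def)
  also have "\<dots> = (\<Sum>i<n. if served N \<mu> i then f i else 0)"
    unfolding ran by (rule sum.inter_filter) simp
  also have "\<dots> = SW n f N \<mu>"
    unfolding SW_def by (intro sum.cong) auto
  finally show ?thesis by simp
qed

lemma OPT_attained:
  assumes "valid_input n v N"
  obtains \<mu> where "is_matching N \<mu>" "OPT n v N = SW n v N \<mu>"
proof -
  have "OPT n v N \<in> SW n v N ` {\<mu>. is_matching N \<mu>}"
    unfolding OPT_def using finite_matchings[OF assms] is_matching_empty by (intro Max_in) auto
  then show ?thesis using that by auto
qed

lemma SW_le_OPT: "valid_input n v N \<Longrightarrow> is_matching N \<mu> \<Longrightarrow> SW n v N \<mu> \<le> OPT n v N"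
  unfolding OPT_def using finite_matchings by (intro Max_ge) auto

text \<open>Weak duality for the matching linear program: \<open>a\<close> and \<open>d\<close> form a fractional vertex cover.\<close>

lemma OPT_le_cover:
  assumes v: "valid_input n v N"
    and cover: "\<And>i j. j < length N \<Longrightarrow> i \<in> N ! j \<Longrightarrow> v i \<le> a i + d j"
    and a: "\<And>i. i < n \<Longrightarrow> 0 \<le> a i" and d: "\<And>j. j < length N \<Longrightarrow> 0 \<le> d j"
  shows "OPT n v N \<le> (\<Sum>i<n. a i) + (\<Sum>j<length N. d j)"
proof -
  obtain \<mu> where m: "is_matching N \<mu>" and opt: "OPT n v N = SW n v N \<mu>"
    using OPT_attained[OF v] .
  have "OPT n v N = (\<Sum>j<length N. item_value v (\<mu> j))"
    using opt SW_eq_sum_items[OF v m] by simp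
  also have "\<dots> \<le> (\<Sum>j<length N. item_value a (\<mu> j) + d j)"
  proof (intro sum_mono)
    fix j assume "j \<in> {..<length N}"
    then show "item_value v (\<mu> j) \<le> item_value a (\<mu> j) + d j"
      using m cover[of j] d[of j] by (cases "\<mu> j") (auto simp: is_matching_def)
  qed
  also have "\<dots> = SW n a N \<mu> + (\<Sum>j<length N. d j)"
    using SW_eq_sum_items[OF v m] by (simp add: sum.distrib)
  also have "SW n a N \<mu> \<le> (\<Sum>i<n. a i)"
    unfolding SW_def using a by (intro sum_mono) auto
  finally show ?thesis by simp
qed

lemma competitive_greedy: "competitive 2 (greedy (\<lambda>_. 1))"
  unfolding competitive_def
proof (intro allI impI)
  fix n v N assume v: "valid_input n v N"
  let ?\<mu> = "outcome (greedy (\<lambda>_. 1)) n v N"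
  have m: "is_matching N ?\<mu>"
    using online_algorithm_greedy v by (auto simp: online_algorithm_def)
  note fin = valid_input_finite[OF v]
  have nonneg: "0 \<le> v i" if "j < length N" "i \<in> N ! j" for i j
    using v nth_mem[OF that(1)] that(2) by (auto simp: valid_input_def)
  have "OPT n v N \<le> (\<Sum>i<n. v i * of_bool (served N ?\<mu> i)) + (\<Sum>j<length N. item_value v (?\<mu> j))"
  proof (rule OPT_le_cover[OF v])
    fix i j assume j: "j < length N" "i \<in> N ! j"
    \<comment> \<open>Either item \<open>j\<close> is worth at least \<open>v i\<close> to its
      winner in the run without \<open>i\<close>, hence also to its winner in the actual run, or
      \<open>i\<close> outbids that winner and is served.\<close>
    have "item_value v (choice v {i} N j) \<le> item_value v (?\<mu> j)"
      using item_value_choice_absent_le[OF fin j(1), of v i] nonneg j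
      by (auto simp: outcome_greedy)
    moreover have "0 \<le> item_value v (?\<mu> j)"
      using m nonneg[OF j(1)] by (cases "?\<mu> j") (auto simp: is_matching_def)
    moreover have "served N ?\<mu> i" if "item_value v (choice v {i} N j) < v i"
      using mem_used_if_score_greater[OF fin j that] v by (simp add: served_greedy_iff)
    ultimately show "v i \<le> v i * of_bool (served N ?\<mu> i) + item_value v (?\<mu> j)"
      by (cases "item_value v (choice v {i} N j) < v i") auto
  next
    fix i assume "i < n"
    then show "0 \<le> v i * of_bool (served N ?\<mu> i)" using v by (simp add: valid_input_def)
  next
    fix j assume "j < length N"
    then show "0 \<le> item_value v (?\<mu> j)"
      using m nonneg[of j] by (cases "?\<mu> j") (auto simp: is_matching_def)
  qed
  also have "\<dots> = 2 * SW n v N ?\<mu>"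
    using SW_eq_sum_items[OF v m, of v] by (simp add: SW_def)
  finally show "OPT n v N \<le> 2 * SW n v N ?\<mu>" .
qed

section \<open>The adversary against deterministic algorithms\<close>

lemma competitive_lower_bound:
  assumes A: "online_algorithm A" and comp: "competitive \<alpha> A"
  shows "2 \<le> \<alpha>"
proof -
  let ?v = "\<lambda>_::nat. 1 :: real"
  let ?N0 = "[{0, 1}] :: graph"
  have v0: "valid_input 2 ?v ?N0" by (auto simp: valid_input_def)
  have m0: "is_matching ?N0 [0 \<mapsto> 0]" by (auto simp: is_matching_def)
  \<comment> \<open>On the single item somebody must be served: welfare 0 is not within any factor
    of an optimum of at least 1.\<close>
  have "1 \<le> OPT 2 ?v ?N0"
    using SW_le_OPT[OF v0 m0] SW_eq_sum_items[OF v0 m0, of ?v] by simp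
  then have "1 \<le> \<alpha> * SW 2 ?v ?N0 (outcome A 2 ?v ?N0)"
    using comp v0 unfolding competitive_def by fastforce
  then have "SW 2 ?v ?N0 (outcome A 2 ?v ?N0) \<noteq> 0" by auto
  then obtain i where "i < 2" "served ?N0 (outcome A 2 ?v ?N0) i"
    unfolding SW_def using sum.neutral by force
  then have i: "A 2 ?v [{0, 1}] = Some i" "i < 2"
    by (auto simp: served_def outcome_def)
  \<comment> \<open>The first decision sees only the first interest set, so it remains the same when
    the second item, wanted only by the served buyer \<open>i\<close>, is added.\<close>
  let ?N = "[{0, 1}, {i}] :: graph" let ?\<mu> = "outcome A 2 ?v ?N"
  have v: "valid_input 2 ?v ?N" using i by (auto simp: valid_input_def)
  have m: "is_matching ?N ?\<mu>" using A v by (simp add: online_algorithm_def)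
  have \<mu>0: "?\<mu> 0 = Some i" using i by (simp add: outcome_def)
  have "?\<mu> 1 = None"
  proof (rule ccontr)
    assume "?\<mu> 1 \<noteq> None"
    then obtain k where k: "?\<mu> 1 = Some k" by blast
    then have "k = i" using m by (force simp: is_matching_def)
    moreover have "inj_on ?\<mu> (dom ?\<mu>)" using m by (simp add: is_matching_def)
    ultimately show False using k \<mu>0 inj_onD[of ?\<mu> "dom ?\<mu>" 0 1] by (simp add: domI)
  qed
  then have "SW 2 ?v ?N ?\<mu> = 1"
    unfolding SW_eq_sum_items[OF v m, of ?v] using \<mu>0 by simp
  \<comment> \<open>In hindsight the first item goes to the other buyer,
    \<open>1 - i\<close>.\<close>
  moreover have m': "is_matching ?N [0 \<mapsto> 1 - i, 1 \<mapsto> i]"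
  proof -
    have "i = 0 \<or> i = 1" using i(2) by auto
    then show ?thesis by (elim disjE) (simp_all add: is_matching_def inj_on_def)
  qed
  have "2 \<le> OPT 2 ?v ?N"
    using SW_le_OPT[OF v m'] unfolding SW_eq_sum_items[OF v m', of ?v] by simp
  moreover have "OPT 2 ?v ?N \<le> \<alpha> * SW 2 ?v ?N ?\<mu>"
    using comp v unfolding competitive_def by blast
  ultimately show ?thesis by simp
qed

section \<open>Ranking with random seeds\<close>

lemma measurable_finite_comparisons:
  assumes s [measurable]: "\<And>i. (\<lambda>\<omega>. s \<omega> i) \<in> borel_measurable M"
    and f: "\<And>\<omega> \<omega>'. (\<And>i k. i < n \<Longrightarrow> k < n \<Longrightarrow> beats (s \<omega>) i k = beats (s \<omega>') i k) \<Longrightarrow> f \<omega> = f \<omega>'"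
  shows "f \<in> measurable M (count_space UNIV)"
proof -
  let ?B = "Pow ({..<n} \<times> {..<n})"
  \<comment> \<open>\<open>f\<close> factors through the comparison pattern \<open>R\<close>, which
    takes finitely many values. The function \<open>g\<close> evaluates \<open>f\<close> at any
    representative of a pattern.\<close>
  define R where "R \<omega> = {p \<in> {..<n} \<times> {..<n}. beats (s \<omega>) (fst p) (snd p)}" for \<omega>
  define g where "g r = f (SOME \<omega>. R \<omega> = r)" for r
  have fg: "f = (\<lambda>\<omega>. g (R \<omega>))"
  proof
    fix \<omega>
    have "R (SOME \<omega>'. R \<omega>' = R \<omega>) = R \<omega>" by (rule someI) simp
    then have "beats (s \<omega>) i k = beats (s (SOME \<omega>'. R \<omega>' = R \<omega>)) i k" if "i < n" "k < n" for i k
      using that by (auto simp: R_def set_eq_iff)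
    then show "f \<omega> = g (R \<omega>)" unfolding g_def by (rule f)
  qed
  have R: "R \<in> measurable M (count_space ?B)"
  proof (subst measurable_count_space_eq2, simp, intro conjI ballI)
    fix a assume a: "a \<in> ?B"
    have "R \<omega> = a \<longleftrightarrow> (\<forall>p\<in>{..<n} \<times> {..<n}. beats (s \<omega>) (fst p) (snd p) = (p \<in> a))" for \<omega>
      using a unfolding R_def by blast
    then have "R -` {a} \<inter> space M =
      {\<omega> \<in> space M. \<forall>p\<in>{..<n} \<times> {..<n}. beats (s \<omega>) (fst p) (snd p) = (p \<in> a)}"
      by blast
    also have "\<dots> \<in> sets M" unfolding beats_def by measurable
    finally show "R -` {a} \<inter> space M \<in> sets M" .
  qed (auto simp: R_def)
  have "(\<lambda>\<omega>. g (R \<omega>)) \<in> measurable M (count_space UNIV)"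
    by (rule measurable_compose[OF R]) (rule measurable_count_space)
  then show ?thesis by (simp only: fg)
qed

lemma measurable_outcome_greedy:
  assumes v: "valid_input n b N" and c: "\<And>i. (\<lambda>\<omega>. c \<omega> i) \<in> borel_measurable M"
  shows "(\<lambda>\<omega>. outcome (greedy (c \<omega>)) n b N) \<in> measurable M (count_space UNIV)"
proof (rule measurable_finite_comparisons[where s = "\<lambda>\<omega> i. b i * c \<omega> i" and n = n
      and f = "\<lambda>\<omega>. outcome (greedy (c \<omega>)) n b N"])
  show "(\<lambda>\<omega>. b i * c \<omega> i) \<in> borel_measurable M" for i
    using c by (intro borel_measurable_times) simp_all
next
  fix \<omega> \<omega>'
  assume *: "\<And>i k. i < n \<Longrightarrow> k < n \<Longrightarrow>
    beats (\<lambda>i. b i * c \<omega> i) i k = beats (\<lambda>i. b i * c \<omega>' i) i k"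
  show "outcome (greedy (c \<omega>)) n b N = outcome (greedy (c \<omega>')) n b N"
  proof (rule greedy_cong[OF v])
    fix i k assume "i \<in> \<Union>(set N)" "k \<in> \<Union>(set N)"
    then have "i < n" "k < n" using v by (auto simp: valid_input_def)
    then show "beats (\<lambda>i. b i * c \<omega> i) i k = beats (\<lambda>i. b i * c \<omega>' i) i k" by (rule *)
  qed
qed

lemma measurable_greedy:
  assumes v: "valid_input n b N" and c: "\<And>i. (\<lambda>\<omega>. c \<omega> i) \<in> borel_measurable M"
  shows "(\<lambda>\<omega>. greedy (c \<omega>) n b N) \<in> measurable M (count_space UNIV)"
proof -
  \<comment> \<open>For \<open>N = []\<close> the truncated index is 0 and both sides are
    \<open>None\<close>.\<close>
  have "greedy (c \<omega>) n b N = outcome (greedy (c \<omega>)) n b N (length N - 1)" for \<omega>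
    by (cases "N = []") (simp_all add: greedy_def outcome_def)
  then show ?thesis
    using measurable_compose[OF measurable_outcome_greedy[OF v, of c M],
        of "\<lambda>\<mu>. \<mu> (length N - 1)" "count_space UNIV"] c by simp
qed

text \<open>The infimum ranges over uncountably many reports, but monotonicity makes the winning
  reports upward closed. Whether it lies below \<open>a\<close> can thus be tested on rational
  reports, a countable union of events.\<close>

lemma measurable_threshold_price:
  assumes v: "valid_input n b N" and i: "i < n"
    and A: "\<And>b. valid_input n b N \<Longrightarrow> (\<lambda>\<omega>. outcome (A \<omega>) n b N) \<in> measurable M (count_space UNIV)"
    and mono: "\<And>\<omega>. \<omega> \<in> space M \<Longrightarrow> monotone_allocation (A \<omega>)"
  shows "(\<lambda>\<omega>. threshold_price (A \<omega>) n b N i) \<in> borel_measurable M"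
  unfolding borel_measurable_iff_less
proof
  fix a :: real
  define S where "S \<omega> = served N (outcome (A \<omega>) n b N) i" for \<omega>
  define T where "T y \<omega> = served N (outcome (A \<omega>) n (b(i := y)) N) i" for y \<omega>
  have [measurable]: "Measurable.pred M S"
    unfolding S_def
    using measurable_compose[OF A[OF v], of "\<lambda>\<mu>. served N \<mu> i" "count_space UNIV"] by simp
  have T: "Measurable.pred M (T y)" if "0 \<le> y" for y
    unfolding T_def
    using measurable_compose[OF A[OF valid_input_upd[OF v that]], of "\<lambda>\<mu>. served N \<mu> i" "count_space UNIV"]
    by simp
  \<comment> \<open>The absolute value makes the report nonnegative for every rational, so
    measurability holds without a side condition under the quantifier over \<open>q\<close>.\<close>
  have [measurable]: "Measurable.pred M (T \<bar>of_rat q\<bar>)" for q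
    by (rule T) simp
  have b: "0 \<le> b i" using v i by (simp add: valid_input_def)
  have *: "threshold_price (A \<omega>) n b N i < a \<longleftrightarrow>
    S \<omega> \<and> (\<exists>q::rat. 0 \<le> q \<and> of_rat q < a \<and> T \<bar>of_rat q\<bar> \<omega>) \<or> \<not> S \<omega> \<and> 0 < a"
    if \<omega>: "\<omega> \<in> space M" for \<omega>
  proof (cases "S \<omega>")
    case True
    have "T (b i) \<omega>" using True by (simp add: S_def T_def)
    then have "{y. 0 \<le> y \<and> T y \<omega>} \<noteq> {}" "bdd_below {y. 0 \<le> y \<and> T y \<omega>}"
      using b by (auto intro: bdd_belowI[of _ 0])
    then have "Inf {y. 0 \<le> y \<and> T y \<omega>} < a \<longleftrightarrow> (\<exists>y. 0 \<le> y \<and> T y \<omega> \<and> y < a)"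
      by (subst cInf_less_iff) auto
    then have "threshold_price (A \<omega>) n b N i < a \<longleftrightarrow> (\<exists>y. 0 \<le> y \<and> T y \<omega> \<and> y < a)"
      using True by (simp add: threshold_price_def S_def T_def)
    also have "\<dots> \<longleftrightarrow> (\<exists>q::rat. 0 \<le> q \<and> of_rat q < a \<and> T \<bar>of_rat q\<bar> \<omega>)"
    proof safe
      fix y assume y: "0 \<le> y" "T y \<omega>" "y < a"
      obtain q :: rat where q: "y < of_rat q" "of_rat q < a"
        using of_rat_dense[OF y(3)] by blast
      moreover have "0 < real_of_rat q" using y(1) q(1) by linarith
      moreover from this have "0 \<le> q" by simp
      moreover have "T (of_rat q) \<omega>"
        using mono[OF \<omega>, unfolded monotone_allocation_def, rule_format, of n b N i y "of_rat q"]
          v i y(1,2) q(1) by (simp add: T_def)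
      ultimately show "\<exists>q::rat. 0 \<le> q \<and> of_rat q < a \<and> T \<bar>of_rat q\<bar> \<omega>"
        by (intro exI[of _ q]) simp
    next
      fix q :: rat assume "0 \<le> q" "of_rat q < a" "T \<bar>of_rat q\<bar> \<omega>"
      then show "\<exists>y. 0 \<le> y \<and> T y \<omega> \<and> y < a"
        by (intro exI[of _ "of_rat q"]) simp
    qed
    finally show ?thesis using True by simp
  next
    case False
    then show ?thesis by (simp add: threshold_price_def S_def)
  qed
  have "{\<omega> \<in> space M. threshold_price (A \<omega>) n b N i < a} =
    {\<omega> \<in> space M. S \<omega> \<and> (\<exists>q::rat. 0 \<le> q \<and> of_rat q < a \<and> T \<bar>of_rat q\<bar> \<omega>) \<or> \<not> S \<omega> \<and> 0 < a}"
    using * by auto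
  also have "\<dots> \<in> sets M"
    by measurable
  finally show "{\<omega> \<in> space M. threshold_price (A \<omega>) n b N i < a} \<in> sets M" .
qed

lemma integrable_SW:
  assumes A: "randomized_online_algorithm M A" and v: "valid_input n b N"
  shows "integrable M (\<lambda>\<omega>. SW n f N (outcome (A \<omega>) n b N))"
proof -
  interpret prob_space M using A by (simp add: randomized_online_algorithm_def)
  have [measurable]: "(\<lambda>\<omega>. A \<omega> n b (take j N)) \<in> measurable M (count_space UNIV)" for j
    using A valid_input_take[OF v] unfolding randomized_online_algorithm_def by blast
  have [measurable]: "Measurable.pred M (\<lambda>\<omega>. served N (outcome (A \<omega>) n b N) i)" for i
  proof -
    have "served N (outcome (A \<omega>) n b N) i \<longleftrightarrow>
      (\<exists>j\<in>{..<length N}. A \<omega> n b (take (Suc j) N) = Some i \<and> i \<in> N ! j)" for \<omega>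
      by (auto simp: served_def outcome_def)
    then show ?thesis by simp
  qed
  have "\<bar>SW n f N \<mu>\<bar> \<le> (\<Sum>i<n. \<bar>f i\<bar>)" for \<mu>
    unfolding SW_def by (rule order_trans[OF sum_abs]) (auto intro!: sum_mono)
  moreover have "(\<lambda>\<omega>. SW n f N (outcome (A \<omega>) n b N)) \<in> borel_measurable M"
    unfolding SW_def by measurable
  ultimately show ?thesis
    by (intro integrable_const_bound[where B = "\<Sum>i<n. \<bar>f i\<bar>"]) auto
qed

section \<open>The seeds and the discount of Ranking\<close>

definition seed :: "real measure" where
  "seed = uniform_measure lborel {0..1}"

text \<open>Every natural number gets a seed, so that one probability space serves all numbers of
  buyers.\<close>

definition seeds :: "(nat \<Rightarrow> real) measure" where
  "seeds = PiM UNIV (\<lambda>_. seed)"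

text \<open>The cut-off at 0 changes nothing on \<open>{0..1}\<close>, where \<open>seed\<close> is
  concentrated. It keeps the multiplier nonnegative for all other seeds, since truthfulness is
  demanded for every seed and not just almost surely.\<close>

definition discount :: "real \<Rightarrow> real" where
  "discount y = max 0 (1 - exp (y - 1))"

definition ranking :: "(nat \<Rightarrow> real) \<Rightarrow> algorithm" where
  "ranking \<omega> = greedy (\<lambda>i. discount (\<omega> i))"

lemma prob_space_seed: "prob_space seed"
  unfolding seed_def by (rule prob_space_uniform_measure) simp_all

lemma prob_space_seeds: "prob_space seeds"
  unfolding seeds_def by (intro prob_space_PiM prob_space_seed)

lemma sets_seed [measurable_cong]: "sets seed = sets borel"
  by (simp add: seed_def)

lemma discount_bounds: "0 \<le> discount y" "discount y \<le> 1"
  by (simp_all add: discount_def)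

lemma measurable_discount [measurable]: "discount \<in> borel_measurable borel"
  unfolding discount_def by measurable

lemma measurable_discount_seeds: "(\<lambda>\<omega>. discount (\<omega> i)) \<in> borel_measurable seeds"
  unfolding seeds_def by measurable

lemma integral_seed:
  fixes f :: "real \<Rightarrow> real"
  assumes "f \<in> borel_measurable borel"
  shows "integral\<^sup>L seed f = (LINT x|lborel. indicator {0..1} x * f x)"
proof -
  have "seed = density lborel (\<lambda>x. ennreal (indicator {0..1} x))"
    unfolding seed_def uniform_measure_def by (intro density_cong) (auto split: split_indicator)
  moreover have "integral\<^sup>L (density lborel (\<lambda>x. ennreal (indicator {0..1} x))) f =
      (LINT x|lborel. indicator {0..1} x *\<^sub>R f x)"
    using assms by (intro integral_density) auto
  ultimately show ?thesis by simp
qed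

text \<open>
  The seed below which buyer \<open>i\<close> outbids \<open>w\<close> is \<open>y = 1 + ln (1 - w / v)\<close>,
  and the shares \<open>exp (x - 1)\<close> integrate over \<open>[0, y]\<close> to \<open>1 - w / v - 1 / e\<close>.
\<close>

lemma seed_share_bound:
  assumes v: "0 \<le> v" and w: "0 \<le> w"
  shows "v * (1 - exp (-1)) \<le> (LINT x|seed. v * (1 - discount x) * of_bool (w < v * discount x) + w)"
    (is "_ \<le> (LINT x|seed. ?f x + w)")
proof -
  interpret prob_space seed by (rule prob_space_seed)
  have nonneg: "0 \<le> ?f x" for x using v discount_bounds(2)[of x] by simp
  have le: "?f x \<le> v" for x
    using v discount_bounds(1)[of x] by (auto simp: mult_left_le)
  have [measurable]: "?f \<in> borel_measurable borel" by measurable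
  have int: "integrable seed ?f"
    using nonneg le by (intro integrable_const_bound[where B = v]) auto
  have sum: "(LINT x|seed. ?f x + w) = (LINT x|seed. ?f x) + w"
    using int by (simp add: prob_space)
  show ?thesis
  proof (cases "v * (1 - exp (-1)) \<le> w")
    \<comment> \<open>The item share \<open>w\<close> alone suffices.\<close>
    case True
    moreover have "0 \<le> (LINT x|seed. ?f x)" by (rule integral_nonneg_AE) (use nonneg in simp)
    ultimately show ?thesis using sum by linarith
  next
    case False
    then have less: "w < v * (1 - exp (-1))" by simp
    then have v0: "0 < v" using v w by (cases "v = 0") auto
    then have r: "exp (-1) < 1 - w / v" using less by (simp add: field_simps)
    have r0: "0 < 1 - w / v" using r exp_gt_zero[of "-1::real"] by linarith
    \<comment> \<open>In this case the critical seed lies in the interval (0, 1].\<close>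
    define y where "y = 1 + ln (1 - w / v)"
    have ey: "exp (y - 1) = 1 - w / v" unfolding y_def using r0 by simp
    have "-1 < y - 1" using r unfolding ey[symmetric] by simp
    then have y0: "0 < y" by simp
    have "exp (y - 1) \<le> exp 0" unfolding ey using w v0 by simp
    then have y1: "y \<le> 1" by simp
    have has: "has_bochner_integral lborel (\<lambda>x. v * exp (x - 1) * indicator {0..y} x)
      (v * exp (y - 1) - v * exp (0 - 1))"
      using y0 v by (intro has_bochner_integral_FTC_Icc_nonneg) (auto intro!: derivative_eq_intros)
    have "v * exp (y - 1) - v * exp (-1) = (LINT x|lborel. v * exp (x - 1) * indicator {0..y} x)"
      using has by (simp add: has_bochner_integral_integral_eq)
    also have "\<dots> \<le> (LINT x|lborel. indicator {0..1} x * ?f x)"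
    proof (rule integral_mono_AE)
      show "integrable lborel (\<lambda>x. v * exp (x - 1) * indicator {0..y} x)"
        using has by (simp add: has_bochner_integral_iff)
      show "integrable lborel (\<lambda>x. indicator {0..1} x * ?f x)"
      proof (rule Bochner_Integration.integrable_bound)
        show "integrable lborel (\<lambda>x::real. v * indicator {0..1} x :: real)" by simp
        show "AE x in lborel. norm (indicator {0..1} x * ?f x) \<le> norm (v * indicator {0..1} x)"
        proof (intro AE_I2)
          have "norm (indicator {0..1} x * t) \<le> norm (v * indicator {0..1} x)"
            if "0 \<le> t" "t \<le> v" for x t :: real
            using that by (simp add: indicator_def)
          then show "norm (indicator {0..1} x * ?f x) \<le> norm (v * indicator {0..1} x)" for x
            using nonneg le .
        qed
      qed measurable
      \<comment> \<open>At \<open>x = y\<close> the buyer only ties with \<open>w\<close>, so this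
        single point is discarded as a null set.\<close>
      show "AE x in lborel. v * exp (x - 1) * indicator {0..y} x \<le> indicator {0..1} x * ?f x"
        using AE_lborel_singleton[of y]
      proof eventually_elim
        case (elim x)
        show ?case
        proof (cases "x \<in> {0..y}")
          case True
          then have "exp (x - 1) < exp (y - 1)" using elim by simp
          then have "exp (x - 1) < 1 - w / v" by (simp add: ey)
          then have "w < v * (1 - exp (x - 1))" using v0 by (simp add: field_simps)
          moreover have "discount x = 1 - exp (x - 1)"
            using True y1 by (simp add: discount_def)
          ultimately show ?thesis using True y1 by (simp add: indicator_def)
        next
          case False
          then show ?thesis using nonneg by simp
        qed
      qed
    qed
    also have "\<dots> = (LINT x|seed. ?f x)"
      by (rule integral_seed[symmetric]) measurable
    finally have "v * (1 - w / v) - v * exp (-1) \<le> (LINT x|seed. ?f x)" unfolding ey .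
    moreover have "v * (1 - w / v) = v - w" using v0 by (simp add: field_simps)
    moreover have "v * (1 - exp (-1)) = v - v * exp (-1)" by (simp add: algebra_simps)
    ultimately show ?thesis using sum by linarith
  qed
qed


section \<open>Ranking as a truthful randomized mechanism\<close>

lemma monotone_allocation_ranking: "monotone_allocation (ranking \<omega>)"
  unfolding ranking_def by (intro monotone_allocation_greedy discount_bounds)

lemma randomized_tardy_mechanism_ranking:
  "randomized_tardy_mechanism seeds ranking (\<lambda>\<omega>. threshold_price (ranking \<omega>))"
  unfolding randomized_tardy_mechanism_def randomized_online_algorithm_def
proof (intro conjI allI impI ballI)
  show "prob_space seeds" by (rule prob_space_seeds)
  show "online_algorithm (ranking \<omega>)" for \<omega>
    unfolding ranking_def by (rule online_algorithm_greedy)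
  show "tardy_mechanism (ranking \<omega>) (threshold_price (ranking \<omega>))" for \<omega>
    unfolding ranking_def by (rule tardy_mechanism_greedy)
  show "(\<lambda>\<omega>. ranking \<omega> n b N) \<in> measurable seeds (count_space UNIV)" if "valid_input n b N" for n b N
    unfolding ranking_def by (rule measurable_greedy[OF that measurable_discount_seeds])
  show "(\<lambda>\<omega>. threshold_price (ranking \<omega>) n b N i) \<in> borel_measurable seeds"
    if "valid_input n b N \<and> i < n" for n b N i
    using that measurable_outcome_greedy[OF _ measurable_discount_seeds]
    by (intro measurable_threshold_price monotone_allocation_ranking) (simp_all add: ranking_def)
qed

lemma randomized_truthful_ranking:
  "randomized_truthful seeds ranking (\<lambda>\<omega>. threshold_price (ranking \<omega>))"
  unfolding randomized_truthful_def
  by (intro ballI truthful_threshold_price monotone_allocation_ranking)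

section \<open>The expected shares cover every edge\<close>

lemma seeds_resample:
  "distr (seed \<Otimes>\<^sub>M PiM (UNIV - {i}) (\<lambda>_. seed)) seeds (\<lambda>(x, X). X(i := x)) = seeds"
  using distr_pair_PiM_eq_PiM[of "UNIV - {i}" "\<lambda>_. seed" i] prob_space_seed
  by (simp add: seeds_def insert_absorb)

definition score :: "valuation \<Rightarrow> (nat \<Rightarrow> real) \<Rightarrow> nat \<Rightarrow> real" where
  "score v \<omega> k = v k * discount (\<omega> k)"

text \<open>
  The value \<open>v i\<close> of a served buyer is split into an item share, her score, and the remaining
  buyer share.  The expected shares, scaled by \<open>e / (e - 1)\<close>, form a fractional vertex cover.
\<close>

definition buyer_share :: "nat \<Rightarrow> valuation \<Rightarrow> graph \<Rightarrow> nat \<Rightarrow> (nat \<Rightarrow> real) \<Rightarrow> real" where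
  "buyer_share n v N i \<omega> =
     v i * (1 - discount (\<omega> i)) * of_bool (served N (outcome (ranking \<omega>) n v N) i)"

definition item_share :: "nat \<Rightarrow> valuation \<Rightarrow> graph \<Rightarrow> nat \<Rightarrow> (nat \<Rightarrow> real) \<Rightarrow> real" where
  "item_share n v N j \<omega> = item_value (score v \<omega>) (outcome (ranking \<omega>) n v N j)"

lemma outcome_ranking:
  "j < length N \<Longrightarrow> outcome (ranking \<omega>) n v N j = choice (score v \<omega>) {} N j"
  by (simp add: ranking_def outcome_greedy score_def[abs_def])

lemma is_matching_ranking: "valid_input n v N \<Longrightarrow> is_matching N (outcome (ranking \<omega>) n v N)"
  using online_algorithm_greedy by (auto simp: online_algorithm_def ranking_def)

lemma valid_input_nonneg: "valid_input n v N \<Longrightarrow> k < n \<Longrightarrow> 0 \<le> v k"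
  by (simp add: valid_input_def)

lemma valid_input_mem_less: "valid_input n v N \<Longrightarrow> j < length N \<Longrightarrow> k \<in> N ! j \<Longrightarrow> k < n"
  unfolding valid_input_def using nth_mem by blast

lemma score_bounds:
  assumes "valid_input n v N" "k < n"
  shows "0 \<le> score v \<omega> k" "score v \<omega> k \<le> v k"
  using valid_input_nonneg[OF assms] discount_bounds[of "\<omega> k"] by (auto simp: score_def mult_left_le)

lemma buyer_share_bounds:
  assumes "valid_input n v N" "i < n"
  shows "0 \<le> buyer_share n v N i \<omega>" "buyer_share n v N i \<omega> \<le> v i"
  using valid_input_nonneg[OF assms] discount_bounds[of "\<omega> i"] by (auto simp: buyer_share_def mult_left_le)

lemma item_share_bounds:
  assumes v: "valid_input n v N" and j: "j < length N"
  shows "0 \<le> item_share n v N j \<omega>" "item_share n v N j \<omega> \<le> (\<Sum>k<n. v k)"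
proof -
  note vnn = valid_input_nonneg[OF v]
  show "0 \<le> item_share n v N j \<omega>" "item_share n v N j \<omega> \<le> (\<Sum>k<n. v k)"
  proof (atomize (full), cases "outcome (ranking \<omega>) n v N j")
    case None
    then show "0 \<le> item_share n v N j \<omega> \<and> item_share n v N j \<omega> \<le> (\<Sum>k<n. v k)"
      using vnn by (auto simp: item_share_def intro: sum_nonneg)
  next
    case (Some k)
    then have k: "k < n"
      using is_matching_ranking[OF v] valid_input_mem_less[OF v j] unfolding is_matching_def by blast
    then have "v k \<le> (\<Sum>k<n. v k)" using vnn by (intro member_le_sum) auto
    then show "0 \<le> item_share n v N j \<omega> \<and> item_share n v N j \<omega> \<le> (\<Sum>k<n. v k)"
      using score_bounds[OF v k, of \<omega>] Some by (simp add: item_share_def)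
  qed
qed

lemma measurable_outcome_ranking:
  assumes "valid_input n v N"
  shows "(\<lambda>\<omega>. g (outcome (ranking \<omega>) n v N)) \<in> measurable seeds (count_space UNIV)"
  using measurable_compose[OF measurable_outcome_greedy[OF assms measurable_discount_seeds],
      of g "count_space UNIV"] by (simp add: ranking_def)

lemma integrable_buyer_share:
  assumes v: "valid_input n v N" and i: "i < n"
  shows "integrable seeds (buyer_share n v N i)"
proof -
  interpret prob_space seeds by (rule prob_space_seeds)
  have [measurable]: "Measurable.pred seeds (\<lambda>\<omega>. served N (outcome (ranking \<omega>) n v N) i)"
    by (rule measurable_outcome_ranking[OF v])
  have [measurable]: "(\<lambda>\<omega>. discount (\<omega> i)) \<in> borel_measurable seeds"
    by (rule measurable_discount_seeds)
  have "buyer_share n v N i \<in> borel_measurable seeds"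
    unfolding buyer_share_def[abs_def] by measurable
  then show ?thesis
    using buyer_share_bounds[OF v i]
    by (intro integrable_const_bound[where B = "v i"]) auto
qed

lemma integrable_item_share:
  assumes v: "valid_input n v N" and j: "j < length N"
  shows "integrable seeds (item_share n v N j)"
proof -
  interpret prob_space seeds by (rule prob_space_seeds)
  have "item_share n v N j \<in> borel_measurable seeds"
    unfolding item_share_def[abs_def]
  \<comment> \<open>The assigned buyer takes countably many values, so measurability may be checked
    with this value held fixed.\<close>
  proof (rule measurable_compose_countable[of "\<lambda>x \<omega>. item_value (score v \<omega>) x"])
    show "(\<lambda>\<omega>. item_value (score v \<omega>) x) \<in> borel_measurable seeds" for x
      using measurable_discount_seeds by (cases x) (simp_all add: score_def)
  qed (rule measurable_outcome_ranking[OF v])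
  then show ?thesis
    using item_share_bounds[OF v j]
    by (intro integrable_const_bound[where B = "\<Sum>k<n. v k"]) auto
qed

text \<open>Fix the seeds \<open>X\<close> of the other buyers and let \<open>w\<close> be the score
  for which item \<open>j\<close> is sold in the run without \<open>i\<close>. For every seed
  \<open>x\<close> of \<open>i\<close> the item share is at least \<open>w\<close>, and
  \<open>i\<close> is served whenever her score exceeds \<open>w\<close>.
  \<open>seed_share_bound\<close> handles the average over \<open>x\<close>, and averaging over
  \<open>X\<close> finishes.\<close>

lemma ranking_edge_cover:
  assumes v: "valid_input n v N" and j: "j < length N" "i \<in> N ! j"
  shows "v i * (1 - exp (-1)) \<le>
    (LINT \<omega>|seeds. buyer_share n v N i \<omega>) + (LINT \<omega>|seeds. item_share n v N j \<omega>)"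
proof -
  note fin = valid_input_finite[OF v]
  have i: "i < n" using valid_input_mem_less[OF v j] .
  note vi = valid_input_nonneg[OF v i]
  have snn: "0 \<le> score v \<omega> k" if "k \<in> N ! j" for \<omega> k
    using score_bounds(1)[OF v valid_input_mem_less[OF v j(1) that]] .
  let ?F = "buyer_share n v N i" and ?G = "item_share n v N j"
  note Fi = integrable_buyer_share[OF v i] and Gi = integrable_item_share[OF v j(1)]

  define P where "P = PiM (UNIV - {i}) (\<lambda>_. seed)"
  interpret U: prob_space seed by (rule prob_space_seed)
  interpret P: prob_space P unfolding P_def by (intro prob_space_PiM prob_space_seed)
  interpret UP: pair_sigma_finite seed P ..
  define H where "H x X = ?F (X(i := x)) + ?G (X(i := x))" for x X
  have upd: "(\<lambda>(x, X). X(i := x)) \<in> measurable (seed \<Otimes>\<^sub>M P) seeds"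
  proof -
    have "(\<lambda>(x, X). X(i := x)) \<in> measurable (seed \<Otimes>\<^sub>M P) (PiM (insert i (UNIV - {i})) (\<lambda>_. seed))"
      unfolding P_def by measurable
    then show ?thesis by (simp add: seeds_def insert_absorb)
  qed
  \<comment> \<open>Splitting off the coordinate \<open>i\<close> lets her seed be integrated first,
    independently of all others.\<close>
  have distr: "distr (seed \<Otimes>\<^sub>M P) seeds (\<lambda>(x, X). X(i := x)) = seeds"
    unfolding P_def by (rule seeds_resample)
  have FG: "integrable seeds (\<lambda>\<omega>. ?F \<omega> + ?G \<omega>)" using Fi Gi by simp
  have Hi: "integrable (seed \<Otimes>\<^sub>M P) (case_prod H)"
    using integrable_distr[OF upd, of "\<lambda>\<omega>. ?F \<omega> + ?G \<omega>"] FG distr by (simp add: H_def case_prod_beta')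
  have "v i * (1 - exp (-1)) \<le> (LINT X|P. LINT x|seed. H x X)"
  proof (rule P.integral_ge_const)
    show "integrable P (\<lambda>X. LINT x|seed. H x X)" by (rule UP.integrable_snd[OF Hi])
    \<comment> \<open>Fubini provides integrability in \<open>x\<close> only for almost every
      \<open>X\<close>.\<close>
    show "AE X in P. v i * (1 - exp (-1)) \<le> (LINT x|seed. H x X)"
      using UP.AE_integrable_snd[OF Hi]
    proof eventually_elim
      case (elim X)
      define w where "w = item_value (score v X) (choice (score v X) {i} N j)"
      have w: "w = item_value (score v (X(i := x))) (choice (score v (X(i := x))) {i} N j)" for x
        unfolding w_def by (rule item_value_choice_absent_cong[OF fin j(1)]) (simp add: score_def)
      have w0: "0 \<le> w"
        using choice_memD(1)[OF fin j(1), of "score v X" "{i}"] snn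
        by (cases "choice (score v X) {i} N j") (auto simp: w_def)
      have le: "v i * (1 - discount x) * of_bool (w < v i * discount x) + w \<le> H x X" for x
      proof -
        have "w \<le> ?G (X(i := x))"
          unfolding w[of x] item_share_def outcome_ranking[OF j(1)] using snn by (intro item_value_choice_absent_le[OF fin j(1)]) auto
        moreover have "v i * (1 - discount x) * of_bool (w < v i * discount x) \<le> ?F (X(i := x))"
        proof (cases "w < v i * discount x")
          case True
          then have "i \<in> used (score v (X(i := x))) {} N"
            using mem_used_if_score_greater[OF fin j, of "score v (X(i := x))"] w[of x] by (simp add: score_def)
          then have "served N (outcome (ranking (X(i := x))) n v N) i"
            unfolding ranking_def served_greedy_iff[OF v] by (simp add: score_def[abs_def])
          with True show ?thesis by (simp add: buyer_share_def)
        next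
          case False
          then show ?thesis using buyer_share_bounds(1)[OF v i] by simp
        qed
        ultimately show ?thesis by (simp add: H_def)
      qed
      have "v i * (1 - exp (-1)) \<le> (LINT x|seed. v i * (1 - discount x) * of_bool (w < v i * discount x) + w)"
        by (rule seed_share_bound[OF vi w0])
      also have "\<dots> \<le> (LINT x|seed. H x X)"
      proof (rule integral_mono)
        have "\<bar>v i * (1 - discount x) * of_bool (w < v i * discount x)\<bar> \<le> v i" for x
          using vi discount_bounds[of x] by (auto simp: abs_mult mult_left_le)
        then have "integrable seed (\<lambda>x. v i * (1 - discount x) * of_bool (w < v i * discount x))"
          by (intro U.integrable_const_bound[where B = "v i"]) auto
        then show "integrable seed (\<lambda>x. v i * (1 - discount x) * of_bool (w < v i * discount x) + w)"
          by simp
      qed (use elim le in auto)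
      finally show ?case .
    qed
  qed
  also have "\<dots> = integral\<^sup>L (seed \<Otimes>\<^sub>M P) (case_prod H)"
    by (rule UP.integral_snd[OF Hi])
  also have "\<dots> = (LINT \<omega>|seeds. ?F \<omega> + ?G \<omega>)"
    using integral_distr[OF upd borel_measurable_integrable[OF FG]] distr
    by (simp add: H_def case_prod_beta')
  also have "\<dots> = (LINT \<omega>|seeds. ?F \<omega>) + (LINT \<omega>|seeds. ?G \<omega>)"
    using Fi Gi by simp
  finally show ?thesis .
qed

lemma randomized_competitive_ranking:
  "randomized_competitive (exp 1 / (exp 1 - 1)) seeds ranking"
  unfolding randomized_competitive_def
proof (intro allI impI)
  fix n v N assume v: "valid_input n v N"
  let ?F = "buyer_share n v N" and ?G = "item_share n v N"
  define \<kappa> :: real where "\<kappa> = 1 - exp (-1)"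
  have \<kappa>: "0 < \<kappa>" by (simp add: \<kappa>_def)
  \<comment> \<open>Counted by buyers, the item shares add up to the scores of the served buyers,
    which complement the buyer shares to full values.\<close>
  have split: "(\<Sum>i<n. ?F i \<omega>) + (\<Sum>j<length N. ?G j \<omega>) = SW n v N (outcome (ranking \<omega>) n v N)" for \<omega>
    unfolding item_share_def SW_eq_sum_items[OF v is_matching_ranking[OF v], symmetric]
    by (simp add: SW_def buyer_share_def score_def algebra_simps flip: sum.distrib)
  have "OPT n v N \<le> (\<Sum>i<n. (LINT \<omega>|seeds. ?F i \<omega>) / \<kappa>) + (\<Sum>j<length N. (LINT \<omega>|seeds. ?G j \<omega>) / \<kappa>)"
  proof (rule OPT_le_cover[OF v])
    fix i j assume "j < length N" "i \<in> N ! j"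
    from ranking_edge_cover[OF v this] \<kappa>
    show "v i \<le> (LINT \<omega>|seeds. ?F i \<omega>) / \<kappa> + (LINT \<omega>|seeds. ?G j \<omega>) / \<kappa>"
      by (simp add: \<kappa>_def[symmetric] pos_le_divide_eq flip: add_divide_distrib)
  next
    fix i assume "i < n"
    then show "0 \<le> (LINT \<omega>|seeds. ?F i \<omega>) / \<kappa>"
      using \<kappa> buyer_share_bounds(1)[OF v] by simp
  next
    fix j assume "j < length N"
    then show "0 \<le> (LINT \<omega>|seeds. ?G j \<omega>) / \<kappa>"
      using \<kappa> item_share_bounds(1)[OF v] by simp
  qed
  also have "\<dots> = ((\<Sum>i<n. (LINT \<omega>|seeds. ?F i \<omega>)) + (\<Sum>j<length N. (LINT \<omega>|seeds. ?G j \<omega>))) / \<kappa>"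
    by (simp add: sum_divide_distrib add_divide_distrib)
  also have "(\<Sum>i<n. (LINT \<omega>|seeds. ?F i \<omega>)) + (\<Sum>j<length N. (LINT \<omega>|seeds. ?G j \<omega>)) =
      (LINT \<omega>|seeds. (\<Sum>i<n. ?F i \<omega>) + (\<Sum>j<length N. ?G j \<omega>))"
    using integrable_buyer_share[OF v] integrable_item_share[OF v]
    by (subst Bochner_Integration.integral_add) (auto simp: Bochner_Integration.integral_sum intro!: Bochner_Integration.integrable_sum)
  also have "\<dots> = (LINT \<omega>|seeds. SW n v N (outcome (ranking \<omega>) n v N))"
    by (simp only: split)
  also have "\<dots> / \<kappa> = exp 1 / (exp 1 - 1) * \<dots>"
    by (simp add: \<kappa>_def exp_minus field_simps)
  finally show "OPT n v N \<le> exp 1 / (exp 1 - 1) * (LINT \<omega>|seeds. SW n v N (outcome (ranking \<omega>) n v N))" .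
qed

section \<open>Lower bound for randomized algorithms\<close>

text \<open>The upper triangular instance of Karp, Vazirani and Vazirani. The buyer of rank
  \<open>k\<close> is \<open>\<pi> k\<close>; she wants exactly the items up to
  \<open>k\<close>.\<close>

definition triangular :: "nat \<Rightarrow> (nat \<Rightarrow> nat) \<Rightarrow> graph" where
  "triangular n \<pi> = map (\<lambda>s. \<pi> ` {s..<n}) [0..<n]"

lemma length_triangular [simp]: "length (triangular n \<pi>) = n"
  by (simp add: triangular_def)

lemma nth_triangular [simp]: "j < n \<Longrightarrow> triangular n \<pi> ! j = \<pi> ` {j..<n}"
  by (simp add: triangular_def)

lemma valid_input_triangular:
  assumes "\<pi> permutes {..<n}"
  shows "valid_input n (\<lambda>_. 1) (triangular n \<pi>)"
proof -
  have "\<pi> k < n" if "k < n" for k using permutes_in_image[OF assms, of k] that by simp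
  then show ?thesis by (auto simp: valid_input_def triangular_def)
qed

lemma OPT_triangular:
  assumes "\<pi> permutes {..<n}"
  shows "real n \<le> OPT n (\<lambda>_. 1) (triangular n \<pi>)"
proof -
  note v = valid_input_triangular[OF assms]
  \<comment> \<open>The diagonal serves every buyer.\<close>
  let ?\<mu> = "\<lambda>j. if j < n then Some (\<pi> j) else None"
  have m: "is_matching (triangular n \<pi>) ?\<mu>"
    using permutes_inj[OF assms] by (auto simp: is_matching_def inj_on_def inj_def dom_def split: if_splits)
  have "SW n (\<lambda>_. 1) (triangular n \<pi>) ?\<mu> = real n"
    by (simp add: SW_eq_sum_items[OF v m])
  then show ?thesis using SW_le_OPT[OF v m] by simp
qed

text \<open>
  The first \<open>t + 1\<close> interest sets are unchanged when two ranks \<open>k, l \<ge> t\<close> are swapped, so item \<open>t\<close>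
  goes to the buyer of rank \<open>k\<close> for at most one in \<open>n - t\<close> of all orders.
\<close>

lemma take_triangular_transpose:
  assumes "t \<le> k" "k < n" "t \<le> l" "l < n"
  shows "take (Suc t) (triangular n (\<pi> \<circ> Transposition.transpose k l)) = take (Suc t) (triangular n \<pi>)"
proof (rule nth_equalityI)
  fix s assume "s < length (take (Suc t) (triangular n (\<pi> \<circ> Transposition.transpose k l)))"
  then have s: "s < Suc t" "s < n" by simp_all
  then have "Transposition.transpose k l permutes {s..<n}" using assms by (intro permutes_swap_id) auto
  then show "take (Suc t) (triangular n (\<pi> \<circ> Transposition.transpose k l)) ! s = take (Suc t) (triangular n \<pi>) ! s"
    using s by (simp add: image_comp[symmetric] permutes_image del: o_apply)
qed simp

definition awards :: "algorithm \<Rightarrow> nat \<Rightarrow> nat \<Rightarrow> nat \<Rightarrow> (nat \<Rightarrow> nat) set" where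
  "awards A n t k =
     {\<pi>. \<pi> permutes {..<n} \<and> A n (\<lambda>_. 1) (take (Suc t) (triangular n \<pi>)) = Some (\<pi> k)}"

text \<open>Composing with the transposition of \<open>k\<close> and \<open>l\<close> is an
  involution on orders. It leaves what the algorithm has seen by item \<open>t\<close> unchanged and
  moves the assigned buyer from rank \<open>k\<close> to rank \<open>l\<close>.\<close>

lemma card_awards_le_card_awards:
  assumes "t \<le> k" "k < n" "t \<le> l" "l < n"
  shows "card (awards A n t k) \<le> card (awards A n t l)"
proof (rule card_inj_on_le)
  show "inj_on (\<lambda>\<pi>. \<pi> \<circ> Transposition.transpose k l) (awards A n t k)"
    by (rule inj_on_inverseI[where g = "\<lambda>\<pi>. \<pi> \<circ> Transposition.transpose k l"]) (simp add: comp_assoc)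
  show "(\<lambda>\<pi>. \<pi> \<circ> Transposition.transpose k l) ` awards A n t k \<subseteq> awards A n t l"
    using assms take_triangular_transpose[OF assms]
    by (auto simp: awards_def intro!: permutes_compose permutes_swap_id)
  show "finite (awards A n t l)"
    by (rule finite_subset[OF _ finite_permutations[OF finite_lessThan[of n]]]) (auto simp: awards_def)
qed

text \<open>Item \<open>t\<close> has at most one recipient, so the sets for the
  \<open>n - t\<close> ranks from \<open>t\<close> on are disjoint, and by symmetry none of them is
  larger than another. Together they contain at most \<open>n!\<close> orders.\<close>

lemma card_awards:
  assumes "t \<le> k" "k < n"
  shows "real (card (awards A n t k)) \<le> fact n / real (n - t)"
proof -
  let ?P = "{\<pi>. \<pi> permutes {..<n}}"
  have fin: "finite (awards A n t l)" for l
    by (rule finite_subset[OF _ finite_permutations[OF finite_lessThan[of n]]]) (auto simp: awards_def)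
  have disj: "awards A n t i \<inter> awards A n t j = {}" if "i \<noteq> j" for i j
  proof (rule ccontr)
    assume "awards A n t i \<inter> awards A n t j \<noteq> {}"
    then obtain \<pi> where "\<pi> \<in> awards A n t i" "\<pi> \<in> awards A n t j" by blast
    then have "inj \<pi>" "\<pi> i = \<pi> j" by (auto simp: awards_def dest: permutes_inj)
    then show False using that by (simp add: inj_eq)
  qed
  have "(n - t) * card (awards A n t k) = (\<Sum>l\<in>{t..<n}. card (awards A n t k))"
    by simp
  also have "\<dots> \<le> (\<Sum>l\<in>{t..<n}. card (awards A n t l))"
    using assms by (intro sum_mono card_awards_le_card_awards) auto
  also have "\<dots> = card (\<Union>l\<in>{t..<n}. awards A n t l)"
    using fin disj by (subst card_UN_disjoint) auto
  also have "\<dots> \<le> card ?P"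
    by (intro card_mono finite_permutations) (auto simp: awards_def)
  also have "\<dots> = fact n"
    by (simp add: card_permutations)
  finally have "real ((n - t) * card (awards A n t k)) \<le> real (fact n)"
    by (rule of_nat_mono)
  moreover have "0 < n - t" using assms by simp
  ultimately show ?thesis by (simp add: pos_le_divide_eq mult.commute)
qed

text \<open>The ranks from the cutoff \<open>K\<close> on are simply counted as served. For a
  smaller rank \<open>k\<close> a union bound runs over the items \<open>t \<le> k\<close>, the only
  ones she wants.\<close>

lemma SW_triangular_le:
  assumes \<pi>: "\<pi> permutes {..<n}" and K: "K \<le> n"
  shows "SW n (\<lambda>_. 1) (triangular n \<pi>) (outcome A n (\<lambda>_. 1) (triangular n \<pi>)) \<le>
    real (n - K) + (\<Sum>k<K. \<Sum>t\<le>k. of_bool (\<pi> \<in> awards A n t k))"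
proof -
  let ?served = "\<lambda>i. served (triangular n \<pi>) (outcome A n (\<lambda>_. 1) (triangular n \<pi>)) i"
  have "SW n (\<lambda>_. 1) (triangular n \<pi>) (outcome A n (\<lambda>_. 1) (triangular n \<pi>)) =
      (\<Sum>i<n. of_bool (?served i))"
    by (simp only: SW_def mult_1)
  also have "\<dots> = (\<Sum>k<n. of_bool (?served (\<pi> k)))"
    using sum.permute[OF \<pi>, of "\<lambda>i. of_bool (?served i) :: real"] by (simp only: comp_def)
  also have "{..<n} = {..<K} \<union> {K..<n}" using K by auto
  also have "(\<Sum>k\<in>{..<K} \<union> {K..<n}. of_bool (?served (\<pi> k)) :: real) =
      (\<Sum>k\<in>{K..<n}. of_bool (?served (\<pi> k))) + (\<Sum>k<K. of_bool (?served (\<pi> k)))"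
    by (subst sum.union_disjoint) (auto simp del: sum_of_bool_eq)
  also have "\<dots> \<le> real (n - K) + (\<Sum>k<K. \<Sum>t\<le>k. of_bool (\<pi> \<in> awards A n t k))"
  proof (intro add_mono sum_mono)
    have "(\<Sum>k\<in>{K..<n}. of_bool (?served (\<pi> k))) \<le> (\<Sum>k\<in>{K..<n}. 1 :: real)"
      by (intro sum_mono) simp
    then show "(\<Sum>k\<in>{K..<n}. of_bool (?served (\<pi> k))) \<le> real (n - K)" by simp
    fix k assume "k \<in> {..<K}"
    show "of_bool (?served (\<pi> k)) \<le> (\<Sum>t\<le>k. of_bool (\<pi> \<in> awards A n t k) :: real)"
    proof (cases "?served (\<pi> k)")
      case True
      then obtain t where t: "t < n" "A n (\<lambda>_. 1) (take (Suc t) (triangular n \<pi>)) = Some (\<pi> k)"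
        "\<pi> k \<in> \<pi> ` {t..<n}"
        by (auto simp: served_def outcome_def)
      then have "t \<le> k" using permutes_inj[OF \<pi>] by (auto simp: inj_eq)
      moreover have "\<pi> \<in> awards A n t k" using t \<pi> by (simp add: awards_def)
      ultimately show ?thesis
        using True member_le_sum[of t "{..k}" "\<lambda>t. of_bool (\<pi> \<in> awards A n t k) :: real"]
        by (simp del: sum_of_bool_eq)
    qed (simp add: sum_nonneg del: sum_of_bool_eq)
  qed
  finally show ?thesis .
qed

text \<open>The term for \<open>t\<close> occurs \<open>K - t\<close> times, and
  \<open>K - t = (n - t) - (n - K)\<close>.\<close>

lemma double_sum_reciprocals:
  assumes "K \<le> n"
  shows "(\<Sum>k<K. \<Sum>t\<le>k. 1 / real (n - t)) = real K - real (n - K) * (\<Sum>t<K. 1 / real (n - t))"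
  using assms
proof (induction K)
  case (Suc K)
  define H where "H = (\<Sum>t<K. 1 / real (n - t))"
  define d where "d = real (n - Suc K)"
  have d: "real (n - K) = d + 1" "0 \<le> d" using Suc.prems by (simp_all add: d_def)
  have "(\<Sum>k<Suc K. \<Sum>t\<le>k. 1 / real (n - t)) = real K - (d + 1) * H + (H + 1 / (d + 1))"
    using Suc by (simp add: H_def d(1)[symmetric] lessThan_Suc_atMost[symmetric])
  also have "\<dots> = real (Suc K) - d * (H + 1 / (d + 1))"
    using d(2) by (simp add: field_simps)
  also have "H + 1 / (d + 1) = (\<Sum>t<Suc K. 1 / real (n - t))"
    by (simp add: H_def d(1))
  finally show ?case unfolding d_def .
qed simp

text \<open>With \<open>d = n - K\<close>, the step to \<open>Suc K\<close> adds
  \<open>ln (1 + 1 / d)\<close> on the left and the larger \<open>1 / d\<close> on the right. The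
  shift by one keeps the denominator positive even at \<open>K = n\<close>.\<close>

lemma sum_reciprocals_ge_ln:
  assumes "K \<le> n"
  shows "ln ((real n + 1) / (real (n - K) + 1)) \<le> (\<Sum>t<K. 1 / real (n - t))"
  using assms
proof (induction K)
  case (Suc K)
  define d where "d = real (n - K)"
  have d: "real (n - Suc K) + 1 = d" "0 < d" using Suc.prems by (simp_all add: d_def)
  have "(real n + 1) / d = (real n + 1) / (d + 1) * (1 + 1 / d)"
    using d(2) by (simp add: divide_simps)
  then have "ln ((real n + 1) / d) = ln ((real n + 1) / (d + 1) * (1 + 1 / d))" by (rule arg_cong)
  also have "\<dots> = ln ((real n + 1) / (d + 1)) + ln (1 + 1 / d)"
    using d(2) by (intro ln_mult_pos) (simp_all add: add_pos_pos)
  also have "\<dots> \<le> (\<Sum>t<K. 1 / real (n - t)) + 1 / d"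
    using Suc d(2) by (intro add_mono ln_add_one_self_le_self) (simp_all add: d_def)
  finally show ?case by (simp add: d(1) d_def)
qed simp

lemma sum_SW_triangular_le:
  assumes m: "m \<le> n"
  shows "(\<Sum>\<pi> | \<pi> permutes {..<n}. SW n (\<lambda>_. 1) (triangular n \<pi>) (outcome A n (\<lambda>_. 1) (triangular n \<pi>)))
    \<le> fact n * (real n - real m * ln ((real n + 1) / (real m + 1)))"
proof -
  let ?P = "{\<pi>. \<pi> permutes {..<n}}"
  \<comment> \<open>\<open>m\<close> is the number of last ranks that are counted as served.\<close>
  define K where "K = n - m"
  have K: "K \<le> n" "n - K = m" "real n = real K + real m" using m by (simp_all add: K_def)
  have finP: "finite ?P" by (simp add: finite_permutations)
  have cardP: "real (card ?P) = fact n" by (simp add: card_permutations)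
  have "(\<Sum>\<pi>\<in>?P. SW n (\<lambda>_. 1) (triangular n \<pi>) (outcome A n (\<lambda>_. 1) (triangular n \<pi>)))
    \<le> (\<Sum>\<pi>\<in>?P. real m + (\<Sum>k<K. \<Sum>t\<le>k. of_bool (\<pi> \<in> awards A n t k)))"
    using SW_triangular_le[OF _ K(1)] K(2) by (intro sum_mono) simp
  also have "\<dots> = fact n * real m + (\<Sum>\<pi>\<in>?P. \<Sum>k<K. \<Sum>t\<le>k. of_bool (\<pi> \<in> awards A n t k))"
    by (simp add: sum.distrib cardP del: sum_of_bool_eq)
  \<comment> \<open>The sum over orders moves inside, where it counts the orders in which item
    \<open>t\<close> goes to rank \<open>k\<close>.\<close>
  also have "(\<Sum>\<pi>\<in>?P. \<Sum>k<K. \<Sum>t\<le>k. of_bool (\<pi> \<in> awards A n t k)) =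
      (\<Sum>k<K. \<Sum>\<pi>\<in>?P. \<Sum>t\<le>k. of_bool (\<pi> \<in> awards A n t k) :: real)"
    by (rule sum.swap)
  also have "\<dots> = (\<Sum>k<K. \<Sum>t\<le>k. \<Sum>\<pi>\<in>?P. of_bool (\<pi> \<in> awards A n t k))"
    by (intro sum.cong refl sum.swap)
  also have "\<dots> = (\<Sum>k<K. \<Sum>t\<le>k. real (card (awards A n t k)))"
  proof (intro sum.cong refl)
    fix k t
    have "?P \<inter> {\<pi>. \<pi> \<in> awards A n t k} = awards A n t k" by (auto simp: awards_def)
    then show "(\<Sum>\<pi>\<in>?P. of_bool (\<pi> \<in> awards A n t k)) = real (card (awards A n t k))"
      using finP by (simp only: sum_of_bool_eq)
  qed
  also have "\<dots> \<le> (\<Sum>k<K. \<Sum>t\<le>k. fact n / real (n - t))"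
    using K by (intro sum_mono card_awards) auto
  also have "\<dots> = fact n * (\<Sum>k<K. \<Sum>t\<le>k. 1 / real (n - t))"
    by (simp add: sum_distrib_left)
  also have "\<dots> = fact n * (real K - real m * (\<Sum>t<K. 1 / real (n - t)))"
    by (simp add: double_sum_reciprocals[OF K(1)] K(2))
  also have "\<dots> \<le> fact n * (real K - real m * ln ((real n + 1) / (real m + 1)))"
    using sum_reciprocals_ge_ln[OF K(1)] K(2) by (intro mult_left_mono diff_left_mono) simp_all
  finally show ?thesis by (simp add: K(3) algebra_simps)
qed

text \<open>With \<open>x = m / n\<close> the bound per buyer tends to \<open>1 + x * ln x\<close>,
  which is minimal at \<open>x = 1 / e\<close> with value \<open>1 - 1 / e\<close>; hence the choice
  of \<open>m\<close>.\<close>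

lemma triangular_bound_limit:
  "(\<lambda>n. 1 - real (nat \<lfloor>real n / exp 1\<rfloor>) / real n *
      ln ((real n + 1) / (real (nat \<lfloor>real n / exp 1\<rfloor>) + 1))) \<longlonglongrightarrow> 1 - exp (-1)"
  unfolding exp_minus by real_asymp


text \<open>Yao's averaging argument: competitiveness is summed over all orders
  \<open>\<pi>\<close>, the sum is exchanged with the expectation, and
  \<open>sum_SW_triangular_le\<close> bounds it for each fixed seed.\<close>

lemma randomized_competitive_lower_bound:
  assumes A: "randomized_online_algorithm M A" and comp: "randomized_competitive \<alpha> M A"
  shows "exp 1 / (exp 1 - 1) \<le> \<alpha>"
proof -
  interpret prob_space M using A by (simp add: randomized_online_algorithm_def)
  define sw where "sw n \<pi> \<omega> = SW n (\<lambda>_. 1) (triangular n \<pi>) (outcome (A \<omega>) n (\<lambda>_. 1) (triangular n \<pi>))"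
    for n \<pi> \<omega>
  have int: "integrable M (sw n \<pi>)" if "\<pi> permutes {..<n}" for n \<pi>
    unfolding sw_def using integrable_SW[OF A valid_input_triangular[OF that]] .
  have opt: "real n \<le> \<alpha> * (LINT \<omega>|M. sw n \<pi> \<omega>)" if "\<pi> permutes {..<n}" for n \<pi>
    using OPT_triangular[OF that] comp valid_input_triangular[OF that]
    unfolding randomized_competitive_def sw_def by (meson order_trans)
  \<comment> \<open>One buyer and one item already force a positive ratio, so that upper bounds may
    later be multiplied by \<open>\<alpha>\<close>.\<close>
  have "0 < \<alpha> * (LINT \<omega>|M. sw 1 id \<omega>)"
    using opt[OF permutes_id, of 1] by simp
  moreover have "0 \<le> (LINT \<omega>|M. sw 1 id \<omega>)"
    by (rule integral_nonneg_AE) (simp add: sw_def SW_def)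
  ultimately have \<alpha>: "0 < \<alpha>" by (simp add: zero_less_mult_iff)
  have bound: "real n \<le> \<alpha> * (real n - real m * ln ((real n + 1) / (real m + 1)))" if "m \<le> n" for n m
  proof -
    let ?P = "{\<pi>. \<pi> permutes {..<n}}"
    have "fact n * real n = (\<Sum>\<pi>\<in>?P. real n)" by (simp add: card_permutations)
    also have "\<dots> \<le> (\<Sum>\<pi>\<in>?P. \<alpha> * (LINT \<omega>|M. sw n \<pi> \<omega>))"
      using opt by (intro sum_mono) simp
    also have "\<dots> = \<alpha> * (LINT \<omega>|M. (\<Sum>\<pi>\<in>?P. sw n \<pi> \<omega>))"
      using int by (simp add: sum_distrib_left[symmetric] Bochner_Integration.integral_sum)
    also have "(LINT \<omega>|M. (\<Sum>\<pi>\<in>?P. sw n \<pi> \<omega>)) \<le> fact n * (real n - real m * ln ((real n + 1) / (real m + 1)))"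
    proof (rule integral_le_const)
      show "integrable M (\<lambda>\<omega>. \<Sum>\<pi>\<in>?P. sw n \<pi> \<omega>)"
        using int by (intro Bochner_Integration.integrable_sum) simp
      show "AE \<omega> in M. (\<Sum>\<pi>\<in>?P. sw n \<pi> \<omega>) \<le> fact n * (real n - real m * ln ((real n + 1) / (real m + 1)))"
        unfolding sw_def by (intro AE_I2 sum_SW_triangular_le that)
    qed
    finally have "fact n * real n \<le> fact n * (\<alpha> * (real n - real m * ln ((real n + 1) / (real m + 1))))"
      using \<alpha> by (simp add: mult.left_commute)
    then show ?thesis by simp
  qed
  define m where "m n = nat \<lfloor>real n / exp 1\<rfloor>" for n
  have m: "m n \<le> n" for n
  proof -
    have "real n / exp 1 \<le> real n"
      using mult_left_mono[of 1 "exp 1" "real n"] by (simp add: divide_le_eq)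
    then show ?thesis unfolding m_def by linarith
  qed
  \<comment> \<open>Divide \<open>bound\<close> by \<open>n\<close> and let \<open>n\<close> tend to
    infinity.\<close>
  have "1 \<le> \<alpha> * (1 - exp (-1))"
  proof (rule LIMSEQ_le_const)
    show "(\<lambda>n. \<alpha> * (1 - real (m n) / real n * ln ((real n + 1) / (real (m n) + 1)))) \<longlonglongrightarrow> \<alpha> * (1 - exp (-1))"
      unfolding m_def by (intro tendsto_mult_left triangular_bound_limit)
    show "\<exists>n0. \<forall>n\<ge>n0. 1 \<le> \<alpha> * (1 - real (m n) / real n * ln ((real n + 1) / (real (m n) + 1)))"
    proof (intro exI[of _ 1] allI impI)
      fix n :: nat assume n: "1 \<le> n"
      let ?L = "ln ((real n + 1) / (real (m n) + 1))"
      have "real n * (\<alpha> * (1 - real (m n) / real n * ?L)) = \<alpha> * (real n - real (m n) * ?L)"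
        using n by (simp add: right_diff_distrib)
      then have "real n * 1 \<le> real n * (\<alpha> * (1 - real (m n) / real n * ?L))"
        using bound[OF m, of n] by (simp only: mult_1_right)
      then show "1 \<le> \<alpha> * (1 - real (m n) / real n * ?L)" using n by simp
    qed
  qed
  then show ?thesis by (simp add: exp_minus field_simps)
qed

theorem theorem3:
  "((\<exists>A P. tardy_mechanism A P \<and> truthful A P \<and> competitive 2 A) \<and>
    (\<forall>A \<alpha>. online_algorithm A \<and> \<alpha> < 2 \<longrightarrow> \<not> competitive \<alpha> A)) \<and>
   ((\<exists>(M :: (nat \<Rightarrow> real) measure) A P.
       randomized_tardy_mechanism M A P \<and> randomized_truthful M A P \<and>
       randomized_competitive (exp 1 / (exp 1 - 1)) M A) \<and>
    (\<forall>(M :: 'w measure) A \<alpha>.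
       randomized_online_algorithm M A \<and> \<alpha> < exp 1 / (exp 1 - 1) \<longrightarrow>
       \<not> randomized_competitive \<alpha> M A))"
proof (intro conjI)
  show "\<exists>A P. tardy_mechanism A P \<and> truthful A P \<and> competitive 2 A"
    using tardy_mechanism_greedy truthful_threshold_price[OF monotone_allocation_greedy] competitive_greedy
    by (metis zero_le_one)
  show "\<forall>A \<alpha>. online_algorithm A \<and> \<alpha> < 2 \<longrightarrow> \<not> competitive \<alpha> A"
    using competitive_lower_bound by (meson not_less)
  show "\<exists>(M :: (nat \<Rightarrow> real) measure) A P.
       randomized_tardy_mechanism M A P \<and> randomized_truthful M A P \<and>
       randomized_competitive (exp 1 / (exp 1 - 1)) M A"
    using randomized_tardy_mechanism_ranking randomized_truthful_ranking randomized_competitive_ranking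
    by blast
  show "\<forall>(M :: 'w measure) A \<alpha>.
       randomized_online_algorithm M A \<and> \<alpha> < exp 1 / (exp 1 - 1) \<longrightarrow>
       \<not> randomized_competitive \<alpha> M A"
    using randomized_competitive_lower_bound by (meson not_less)
qed

end
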